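(* Let $\mathbf{S}^2_{\mathrm{I}},\mathbf{S}^2_{\mathrm{II}}\subset\mathbb{R}^3$ and $\mathbf{S}^2_{\mathrm{III}}\subset\mathbb{R}^4$ be the spheres, and $L_{(\mathcal X,\mathcal Z)}$ the Lagrange numbers, defined in the context. (a) There exist a point $\mathbf{n}\in\mathbf{S}^2_{\mathrm{I}}\cap\mathbb{Q}^3$ and a continuous bijection $\Phi^2_{\mathrm{I}}:\mathbb{C}\to\mathbf{S}^2_{\mathrm{I}}\setminus\{\mathbf{n}\}$ which maps $\mathbb{Q}(\sqrt{-1})$ onto $(\mathbf{S}^2_{\mathrm{I}}\cap\mathbb{Q}^3)\setminus\{\mathbf{n}\}$ and satisfies $$L_{(\mathbb{C},\mathbb{Q}(\sqrt{-1}))}(\xi)=\sqrt2\,L_{(\mathbf{S}^2_{\mathrm{I}},\,\mathbf{S}^2_{\mathrm{I}}\cap\mathbb{Q}^3)}(\Phi^2_{\mathrm{I}}(\xi))\quad\text{for every }\xi\in\mathbb{C}\setminus\mathbb{Q}(\sqrt{-1}).$$ (b) There exist a point $\mathbf{n}\in\mathbf{S}^2_{\mathrm{II}}\cap\mathbb{Q}^3$ and a continuous bijection $\Phi^2_{\mathrm{II}}:\mathbb{C}\to\mathbf{S}^2_{\mathrm{II}}\setminus\{\mathbf{n}\}$ which maps $\mathbb{Q}(\sqrt{-2})$ onto $(\mathbf{S}^2_{\mathrm{II}}\cap\mathbb{Q}^3)\setminus\{\mathbf{n}\}$ and satisfies $$L_{(\mathbb{C},\mathbb{Q}(\sqrt{-2}))}(\xi)=\sqrt2\,L_{(\mathbf{S}^2_{\mathrm{II}},\,\mathbf{S}^2_{\mathrm{II}}\cap\mathbb{Q}^3)}(\Phi^2_{\mathrm{II}}(\xi))\quad\text{for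 every }\xi\in\mathbb{C}\setminus\mathbb{Q}(\sqrt{-2}).$$ (c) There exist a point $\mathbf{n}\in\mathbf{S}^2_{\mathrm{III}}\cap\mathbb{Q}^4$ and a continuous bijection $\Phi^2_{\mathrm{III}}:\mathbb{C}\to\mathbf{S}^2_{\mathrm{III}}\setminus\{\mathbf{n}\}$ which maps $\mathbb{Q}(\sqrt{-3})$ onto $(\mathbf{S}^2_{\mathrm{III}}\cap\mathbb{Q}^4)\setminus\{\mathbf{n}\}$ and satisfies $$L_{(\mathbb{C},\mathbb{Q}(\sqrt{-3}))}(\xi)=\sqrt2\,L_{(\mathbf{S}^2_{\mathrm{III}},\,\mathbf{S}^2_{\mathrm{III}}\cap\mathbb{Q}^4)}(\Phi^2_{\mathrm{III}}(\xi))\quad\text{for every }\xi\in\mathbb{C}\setminus\mathbb{Q}(\sqrt{-3}).$$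
   Context: Lagrange numbers. Let $(\mathcal X,\mathrm d)$ be a complete metric space, $\mathcal Z\subset\mathcal X$ a countable dense subset, and $\mathrm{Ht}_{\mathcal Z}:\mathcal Z\to\mathbb{R}_{\ge0}$ a height function. For $P\in\mathcal X\setminus\mathcal Z$, $$L_{(\mathcal X,\mathcal Z)}(P)=\limsup_{Z\in\mathcal Z}\frac{1}{\mathrm{Ht}_{\mathcal Z}(Z)\,\mathrm d(P,Z)}\in[0,\infty],$$ where the limsup over the countable set $\mathcal Z$ is $\inf_{F\subset\mathcal Z\text{ finite}}\ \sup_{Z\in\mathcal Z\setminus F}$ (equivalently, the supremum of those $L\ge 0$ for which $\mathrm d(P,Z)<1/(L\,\mathrm{Ht}_{\mathcal Z}(Z))$ has infinitely many solutions $Z\in\mathcal Z$). Spheres. $\mathbf{S}^2_{\mathrm{I}}=\{(x_1,x_2,x_3)\in\mathbb{R}^3: x_1^2+x_2^2+x_3^2=1\}$; $\mathbf{S}^2_{\mathrm{II}}=\{(x_1,x_2,x_3)\in\mathbb{R}^3: x_1^2+x_2^2+x_3^2=2\}$; $\mathbf{S}^2_{\mathrm{III}}=\{(x_0,x_1,x_2,x_3)\in\mathbb{R}^4: x_0+x_1+x_2+x_3=1,\ x_0^2+x_1^2+x_2^2+x_3^2=1\}$. The distance on each is the Euclidean distance of the ambient $\mathbb{R}^l$ ($l=3,3,4$). The height of a rational point is $\mathrm{Ht}(\mathbf p/q)=|q|$, where $\mathbf p\in\mathbb{Z}^l$ is primitive (its coordinates have no common divisor $>1$) and $q$ is a nonzero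 integer (on these spheres this is equivalent to requiring that the coordinates of $\mathbf p$ together with $q$ have gcd $1$). Complex plane. The distance on $\mathbb{C}$ is $|z-w|$. For $K=\mathbb{Q}(\sqrt{-1}),\mathbb{Q}(\sqrt{-2}),\mathbb{Q}(\sqrt{-3})$, viewed as a subset of $\mathbb{C}$, with ring of integers $\mathcal O_K$ (of class number one), write $z\in K$ as $z=\alpha/\beta$ with $\alpha,\beta\in\mathcal O_K$ generating the unit ideal $\mathcal O_K$; the height is $\mathrm{Ht}_K(z)=|\beta|^2$ (well defined, since $\alpha/\beta$ is unique up to a unit). *)

theory Defs
  imports "HOL-Analysis.Analysis" "HOL-Computational_Algebra.Polynomial"
begin

(* The metric of the space X is (the restriction of) dist, so X itself does not enter the formula.
   In ennreal, 1 / 0 is infinity. *)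
definition lagrange_number ::
    "'a::metric_space set \<Rightarrow> ('a \<Rightarrow> real) \<Rightarrow> 'a \<Rightarrow> ennreal" where
  "lagrange_number Z Ht P =
     (INF F \<in> {F. finite F \<and> F \<subseteq> Z}. SUP z \<in> Z - F. 1 / ennreal (Ht z * dist P z))"

definition sphere_I :: "(real^3) set" where
  "sphere_I = {x. (\<Sum>i\<in>UNIV. (x $ i)\<^sup>2) = 1}"

definition sphere_II :: "(real^3) set" where
  "sphere_II = {x. (\<Sum>i\<in>UNIV. (x $ i)\<^sup>2) = 2}"

definition sphere_III :: "(real^4) set" where
  "sphere_III = {x. (\<Sum>i\<in>UNIV. x $ i) = 1 \<and> (\<Sum>i\<in>UNIV. (x $ i)\<^sup>2) = 1}"

definition rational_points :: "(real^'n) set" where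
  "rational_points = {x. \<forall>i. x $ i \<in> \<rat>}"

(* Meaningful for points having a representation p / q with p primitive and q an integer. Every
   rational point of the three spheres has one, and it is unique up to the common sign of p and q. *)
definition rational_height :: "real^'n \<Rightarrow> real" where
  "rational_height x =
     (THE h. \<exists>(p :: int^'n) (q :: int). Gcd (range (\<lambda>i. p $ i)) = 1 \<and> q \<noteq> 0 \<and>
        x = (\<chi> i. of_int (p $ i) / of_int q) \<and> h = of_int \<bar>q\<bar>)"

definition quadratic_field :: "int \<Rightarrow> complex set" where
  "quadratic_field m = {of_rat a + of_rat b * csqrt (of_int m) | a b. True}"

definition ring_of_integers :: "complex set \<Rightarrow> complex set" where
  "ring_of_integers K = {z \<in> K. algebraic_int z}"

(* Meaningful for elements of a number field K of class number one; the value does not depend on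
   the representation alpha / beta, which is unique up to a unit. *)
definition field_height :: "complex set \<Rightarrow> complex \<Rightarrow> real" where
  "field_height K z =
     (THE h. \<exists>\<alpha>\<in>ring_of_integers K. \<exists>\<beta>\<in>ring_of_integers K.
        (\<exists>u\<in>ring_of_integers K. \<exists>v\<in>ring_of_integers K. u * \<alpha> + v * \<beta> = 1) \<and>
        \<beta> \<noteq> 0 \<and> z = \<alpha> / \<beta> \<and> h = (cmod \<beta>)\<^sup>2)"

end

(* Each sphere is the projectivised light cone of an integral quadratic form Q of signature (1,3).
   Splitting off a hyperbolic plane spanned by two rational points e = n and f of the cone leaves
   the negative norm form of the ring of integers O of K (up to scaling), so the integral points of
   the cone are a e + c f + b with a c = |b|^2. For z = alpha / beta in lowest terms, the point
   |alpha|^2 e + |beta|^2 f + alpha (cnj beta) is primitive on the cone; this defines Phi, and its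
   height is |beta|^2 N(z) for a continuous positive function N. Polarising Q gives
   dist (Phi z) (Phi w) = sqrt 2 * |z - w| / sqrt (N z * N w). Hence the two approximation
   quantities differ by the factor sqrt 2 * sqrt (N z / N xi), which tends to sqrt 2 as z tends to
   xi, while only finitely many z away from xi satisfy any given bound on
   height times distance. *)
theory Submission
  imports Defs
begin

text \<open>The constant sqrt 2 is the same for all three spheres: if P/N and P'/N' both have
  squared norm kappa, their squared distance is 2 kappa - 2 (P . P') / (N N'), and P . P' = kappa N
  N' - |z - w|^2 makes kappa cancel. The delicate point is arithmetic. The height asks for the
  vector p alone to be primitive, whereas a reduced fraction alpha / beta only provides a Bezout
  identity over the order. The squared modulus of that identity is an identity of integers, linear
  in the cone coordinates a, c, s, t with b = s + t theta. Hence it is enough to recover the linear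
  forms occurring in it as integer combinations of p and q, and to see that a common divisor of the
  entries of p divides q as well. On the analytic side, a positive lower bound for N turns a bound
  on height times distance on the sphere into one in the plane.\<close>

section \<open>Lagrange numbers and rational heights\<close>

text \<open>In this form a Lagrange number depends only on which sets of z are finite, and
  finiteness survives injective reindexing and the addition of one point. For the two inequalities,
  a finite exceedance set serves as \<open>F\<close>, and a supremum outside \<open>F\<close> serves
  as threshold.\<close>

lemma lagrange_number_eq_Inf:
  "lagrange_number Z Ht P =
     Inf {c. finite {z \<in> Z. c < 1 / ennreal (Ht z * dist P z)}}"
  (is "?l = Inf ?C")
proof (rule antisym)
  show "?l \<le> Inf ?C"
  proof (rule Inf_greatest)
    fix c assume "c \<in> ?C"
    then have "?l \<le> (SUP z \<in> Z - {z \<in> Z. c < 1 / ennreal (Ht z * dist P z)}.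
        1 / ennreal (Ht z * dist P z))"
      unfolding lagrange_number_def by (intro INF_lower) auto
    also have "\<dots> \<le> c"
      by (intro SUP_least) auto
    finally show "?l \<le> c" .
  qed
  show "Inf ?C \<le> ?l"
    unfolding lagrange_number_def
  proof (rule INF_greatest)
    fix F assume F: "F \<in> {F. finite F \<and> F \<subseteq> Z}"
    let ?s = "SUP z \<in> Z - F. 1 / ennreal (Ht z * dist P z)"
    have "{z \<in> Z. ?s < 1 / ennreal (Ht z * dist P z)} \<subseteq> F"
    proof safe
      fix z assume "z \<in> Z" and z: "?s < 1 / ennreal (Ht z * dist P z)"
      show "z \<in> F"
      proof (rule ccontr)
        assume "z \<notin> F"
        with \<open>z \<in> Z\<close> have "1 / ennreal (Ht z * dist P z) \<le> ?s"
          by (intro SUP_upper) auto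
        with z show False
          by (simp add: leD)
      qed
    qed
    with F have "?s \<in> ?C"
      by (auto intro: finite_subset)
    then show "Inf ?C \<le> ?s"
      by (rule Inf_lower)
  qed
qed

text \<open>Multiplication by \<open>ennreal k\<close> is an order isomorphism with inverse
  multiplication by \<open>ennreal (1 / k)\<close>, so it passes through the infimum. Where the
  product of height and distance is not positive, both reciprocals are infinite. The lemma serves to
  absorb the factor sqrt 2 into the height.\<close>

lemma cmult_lagrange_number:
  assumes "k > 0"
  shows "ennreal k * lagrange_number Z Ht P = lagrange_number Z (\<lambda>z. Ht z / k) P"
proof -
  have *: "ennreal k * (1 / ennreal x) = 1 / ennreal (x / k)" for x
  proof (cases "x > 0")
    case True
    then have "1 / ennreal x = ennreal (1 / x)" "1 / ennreal (x / k) = ennreal (1 / (x / k))"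
      using assms by (simp_all only: divide_ennreal divide_pos_pos less_imp_le zero_le_one flip: ennreal_1)
    moreover have "ennreal k * ennreal (1 / x) = ennreal (1 / (x / k))"
      using True assms by (simp flip: ennreal_mult)
    ultimately show ?thesis
      by simp
  next
    case False
    with assms show ?thesis
      by (simp add: ennreal_neg divide_nonpos_pos ennreal_mult_top divide_ennreal_def)
  qed
  have INF_cmult: "ennreal k * (INF i\<in>I. f i) = (INF i\<in>I. ennreal k * f i)"
    if "I \<noteq> {}" for I and f :: "'a set \<Rightarrow> ennreal"
  proof (rule antisym)
    have k: "ennreal k * (ennreal (1 / k) * c) = c" "ennreal (1 / k) * (ennreal k * c) = c" for c
      using assms by (simp_all flip: mult.assoc ennreal_mult)
    show "ennreal k * (INF i\<in>I. f i) \<le> (INF i\<in>I. ennreal k * f i)"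
      by (intro INF_greatest mult_left_mono INF_lower) auto
    have "ennreal (1 / k) * (INF i\<in>I. ennreal k * f i) \<le> (INF i\<in>I. f i)"
    proof (intro INF_greatest)
      fix i assume "i \<in> I"
      then have "ennreal (1 / k) * (INF i\<in>I. ennreal k * f i) \<le> ennreal (1 / k) * (ennreal k * f i)"
        by (intro mult_left_mono INF_lower) auto
      then show "ennreal (1 / k) * (INF i\<in>I. ennreal k * f i) \<le> f i"
        by (simp add: k)
    qed
    then have "ennreal k * (ennreal (1 / k) * (INF i\<in>I. ennreal k * f i)) \<le> ennreal k * (INF i\<in>I. f i)"
      by (rule mult_left_mono) auto
    then show "(INF i\<in>I. ennreal k * f i) \<le> ennreal k * (INF i\<in>I. f i)"
      by (simp add: k)
  qed
  have "{F. finite F \<and> F \<subseteq> Z} \<noteq> {}"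
    by blast
  then show ?thesis
    unfolding lagrange_number_def by (simp add: INF_cmult SUP_mult_left_ennreal *)
qed

text \<open>For use with \<open>n\<close> the one rational point of the sphere that the
  parametrization misses: a single point does not change whether an exceedance set is
  finite.\<close>

lemma lagrange_number_insert_image:
  assumes "inj_on \<Phi> Z"
  shows "lagrange_number (insert n (\<Phi> ` Z)) Ht P =
           Inf {c. finite {z \<in> Z. c < 1 / ennreal (Ht (\<Phi> z) * dist P (\<Phi> z))}}"
proof -
  have "finite {z \<in> insert n (\<Phi> ` Z). c < 1 / ennreal (Ht z * dist P z)} \<longleftrightarrow>
        finite {z \<in> Z. c < 1 / ennreal (Ht (\<Phi> z) * dist P (\<Phi> z))}" (is "finite ?A \<longleftrightarrow> finite ?B") for c
  proof -
    have "?A - {n} = \<Phi> ` ?B - {n}"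
      by auto
    moreover have "finite (\<Phi> ` ?B) \<longleftrightarrow> finite ?B"
      using assms by (intro finite_image_iff) (auto intro: inj_on_subset)
    ultimately show ?thesis
      using finite_Diff2[of "{n}" ?A] finite_Diff2[of "{n}" "\<Phi> ` ?B"] by simp
  qed
  then show ?thesis
    by (simp add: lagrange_number_eq_Inf)
qed

text \<open>A reciprocal of \<open>f z\<close> above r + e forces \<open>f z\<close> to be at most 1
  / e. So \<open>g\<close> has to be compared with \<open>f\<close> only where \<open>f\<close> is
  bounded, and there up to finitely many z and a factor arbitrarily close to 1.\<close>

lemma Inf_finite_reciprocal_le:
  fixes f g :: "'a \<Rightarrow> real"
  assumes pos: "\<And>z. z \<in> Z \<Longrightarrow> 0 < f z" "\<And>z. z \<in> Z \<Longrightarrow> 0 < g z"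
    and close: "\<And>e M. 0 < e \<Longrightarrow> finite {z \<in> Z. f z \<le> M \<and> (1 + e) * f z < g z}"
  shows "Inf {c. finite {z \<in> Z. c < 1 / ennreal (f z)}} \<le> Inf {c. finite {z \<in> Z. c < 1 / ennreal (g z)}}"
    (is "?L \<le> _")
proof (rule Inf_greatest)
  fix c assume "c \<in> {c. finite {z \<in> Z. c < 1 / ennreal (g z)}}"
  then have c: "finite {z \<in> Z. c < 1 / ennreal (g z)}"
    by simp
  show "?L \<le> c"
  proof (cases c)
    case top
    then show ?thesis by simp
  next
    case (real r)
    show ?thesis
    proof (rule ennreal_le_epsilon)
      fix e :: real assume e: "0 < e"
      \<comment> \<open>Chosen for (1 + d) r <= r + e; the denominator r + 1 covers r = 0.\<close>
      define d where "d = e / (r + 1)"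
      have d: "0 < d" "(1 + d) * r \<le> r + e"
        using e real by (auto simp: d_def field_simps)
      have "{z \<in> Z. ennreal (r + e) < 1 / ennreal (f z)} \<subseteq>
            {z \<in> Z. c < 1 / ennreal (g z)} \<union> {z \<in> Z. f z \<le> 1 / e \<and> (1 + d) * f z < g z}"
      proof safe
        fix z assume z: "z \<in> Z" "ennreal (r + e) < 1 / ennreal (f z)" "\<not> c < 1 / ennreal (g z)"
        have "r + e < 1 / f z" "1 / g z \<le> r"
          using z pos[of z] real e
          by (simp_all add: divide_ennreal ennreal_less_iff not_less del: ennreal_plus flip: ennreal_1)
        with e real have "e < 1 / f z"
          by linarith
        with e pos[OF z(1)] show "f z \<le> 1 / e"
          by (simp add: field_simps)
        show "(1 + d) * f z < g z"
        proof (rule ccontr)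
          assume "\<not> (1 + d) * f z < g z"
          then have "1 / f z \<le> (1 + d) * (1 / g z)"
            using pos[OF z(1)] by (simp add: field_simps)
          also have "\<dots> \<le> (1 + d) * r"
            using \<open>1 / g z \<le> r\<close> d by (intro mult_left_mono) auto
          finally show False
            using \<open>r + e < 1 / f z\<close> d by linarith
        qed
      qed
      then have "finite {z \<in> Z. ennreal (r + e) < 1 / ennreal (f z)}"
        using c close[OF d(1)] by (auto intro: finite_subset)
      then show "?L \<le> c + ennreal e"
        using real e by (intro Inf_lower) (simp add: ennreal_plus)
    qed
  qed
qed

text \<open>Two representations satisfy q' p = q p'. Taking the Gcd of the entries on both sides
  leaves |q'| = |q|, since p and p' are primitive.\<close>

lemma rational_height_eq:
  fixes p :: "int^'n"
  assumes "Gcd (range (\<lambda>i. p $ i)) = 1" "q \<noteq> 0"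
  shows "rational_height (\<chi> i. of_int (p $ i) / of_int q) = of_int \<bar>q\<bar>"
  unfolding rational_height_def
proof (rule the_equality)
  show "\<exists>p' q'. Gcd (range (\<lambda>i. p' $ i)) = 1 \<and> q' \<noteq> 0 \<and>
      (\<chi> i. real_of_int (p $ i) / of_int q) = (\<chi> i. of_int (p' $ i) / of_int q') \<and>
      real_of_int \<bar>q\<bar> = of_int \<bar>q'\<bar>"
    using assms by blast
  fix h :: real assume "\<exists>p' q'. Gcd (range (\<lambda>i. p' $ i)) = 1 \<and> q' \<noteq> 0 \<and>
      (\<chi> i. real_of_int (p $ i) / of_int q) = (\<chi> i. of_int (p' $ i) / of_int q') \<and>
      h = of_int \<bar>q'\<bar>"
  then obtain p' :: "int^'n" and q' where *: "Gcd (range (\<lambda>i. p' $ i)) = 1" "q' \<noteq> 0"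
      "\<And>i. real_of_int (p $ i) / of_int q = of_int (p' $ i) / of_int q'" "h = of_int \<bar>q'\<bar>"
    by (auto simp: vec_eq_iff)
  have "q' * p $ i = q * p' $ i" for i
  proof -
    have "real_of_int (q' * p $ i) = of_int (q * p' $ i)"
      using *(2) *(3)[of i] assms(2) by (simp add: field_simps)
    then show ?thesis
      by (simp only: of_int_eq_iff)
  qed
  then have "(*) q' ` range (\<lambda>i. p $ i) = (*) q ` range (\<lambda>i. p' $ i)"
    by (simp add: image_image)
  then have "Gcd ((*) q' ` range (\<lambda>i. p $ i)) = Gcd ((*) q ` range (\<lambda>i. p' $ i))"
    by (rule arg_cong)
  then show "h = of_int \<bar>q\<bar>"
    using *(1,4) assms(1) by (simp add: Gcd_mult)
qed

section \<open>Euclidean imaginary quadratic orders\<close>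

text \<open>The instances have trace and norm (0, 1), (0, 2), (1, 1): the Gaussian integers,
  Z[sqrt(-2)], and the Eisenstein integers with \<open>\<theta>\<close> a primitive sixth root of
  unity. Rounding both coordinates in the basis 1, \<open>\<theta>\<close> leaves a remainder of
  norm at most (1 + tau + nu) / 4, and \<open>trace_plus_norm_le\<close> keeps this at most 3/4; so
  the order is norm-Euclidean.\<close>

locale euclidean_quadratic_order =
  fixes \<theta> :: complex and \<tau> \<nu> :: int
  assumes theta_square: "\<theta>\<^sup>2 = of_int \<tau> * \<theta> - of_int \<nu>"
    and Im_theta_pos: "0 < Im \<theta>"
    and trace_nonneg: "0 \<le> \<tau>" and norm_nonneg: "0 \<le> \<nu>"
    and trace_plus_norm_le: "\<tau> + \<nu> \<le> 2"
begin

text \<open>The coefficients are real so that one coordinate system serves the order (integer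
  coefficients), its field (rational ones) and the whole plane, on which the map to the sphere is
  defined.\<close>

definition lin_comb :: "real \<Rightarrow> real \<Rightarrow> complex" where
  "lin_comb s t = of_real s + of_real t * \<theta>"

definition quad_order :: "complex set" where
  "quad_order = {lin_comb (of_int a) (of_int b) | a b. True}"

definition quad_field :: "complex set" where
  "quad_field = {lin_comb a b | a b. a \<in> \<rat> \<and> b \<in> \<rat>}"

definition coprime_pair :: "complex \<Rightarrow> complex \<Rightarrow> bool" where
  "coprime_pair \<alpha> \<beta> \<longleftrightarrow> \<alpha> \<in> quad_order \<and> \<beta> \<in> quad_order \<and> (\<exists>u\<in>quad_order. \<exists>v\<in>quad_order. u * \<alpha> + v * \<beta> = 1)"

definition coord1 :: "complex \<Rightarrow> real" where
  "coord1 z = Re z - Im z / Im \<theta> * Re \<theta>"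

definition coord2 :: "complex \<Rightarrow> real" where
  "coord2 z = Im z / Im \<theta>"

section \<open>Arithmetic in the basis 1, \<open>\<theta>\<close>\<close>

lemma Re_theta: "Re \<theta> = of_int \<tau> / 2"
proof -
  have "2 * Re \<theta> * Im \<theta> = of_int \<tau> * Im \<theta>"
    using arg_cong[OF theta_square, of Im] by (simp add: power2_eq_square)
  then show ?thesis
    using Im_theta_pos by simp
qed

lemma Im_theta_square: "(Im \<theta>)\<^sup>2 = of_int \<nu> - (of_int \<tau>)\<^sup>2 / 4"
  using arg_cong[OF theta_square, of Re] by (simp add: power2_eq_square Re_theta field_simps)

lemma Re_lin_comb: "Re (lin_comb s t) = s + t * of_int \<tau> / 2"
  and Im_lin_comb: "Im (lin_comb s t) = t * Im \<theta>"
  by (simp_all add: lin_comb_def Re_theta)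

lemma cmod_lin_comb_square: "(cmod (lin_comb s t))\<^sup>2 = s\<^sup>2 + of_int \<tau> * s * t + of_int \<nu> * t\<^sup>2"
  by (simp add: cmod_power2 Re_lin_comb Im_lin_comb power_mult_distrib Im_theta_square)
    (simp add: power2_eq_square field_simps)

lemma lin_comb_coord [simp]: "lin_comb (coord1 z) (coord2 z) = z"
  using Im_theta_pos by (simp add: complex_eq_iff lin_comb_def coord1_def coord2_def)

lemma coord1_lin_comb [simp]: "coord1 (lin_comb s t) = s"
  and coord2_lin_comb [simp]: "coord2 (lin_comb s t) = t"
  using Im_theta_pos by (simp_all add: lin_comb_def coord1_def coord2_def)

lemma lin_comb_add: "lin_comb s t + lin_comb s' t' = lin_comb (s + s') (t + t')"
  and lin_comb_diff: "lin_comb s t - lin_comb s' t' = lin_comb (s - s') (t - t')"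
  and of_real_mult_lin_comb: "of_real c * lin_comb s t = lin_comb (c * s) (c * t)"
  by (simp_all add: lin_comb_def algebra_simps)

lemma lin_comb_mult:
  "lin_comb s t * lin_comb s' t' =
     lin_comb (s * s' - of_int \<nu> * t * t') (s * t' + t * s' + of_int \<tau> * t * t')"
proof -
  have "lin_comb s t * lin_comb s' t' = s * s' + (s * t' + t * s') * \<theta> + t * t' * \<theta>\<^sup>2"
    by (simp add: lin_comb_def algebra_simps power2_eq_square)
  then show ?thesis
    by (simp add: theta_square lin_comb_def algebra_simps)
qed

lemma cnj_lin_comb: "cnj (lin_comb s t) = lin_comb (s + of_int \<tau> * t) (- t)"
  by (simp add: complex_eq_iff Re_lin_comb Im_lin_comb algebra_simps)

lemma lin_comb_quad_order [intro]: "lin_comb (of_int a) (of_int b) \<in> quad_order"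
  unfolding quad_order_def by blast

lemma quad_orderE:
  assumes "x \<in> quad_order"
  obtains a b :: int where "x = lin_comb a b"
  using assms unfolding quad_order_def by blast

lemma quad_order_add [intro]: "x \<in> quad_order \<Longrightarrow> y \<in> quad_order \<Longrightarrow> x + y \<in> quad_order"
  by (elim quad_orderE) (simp add: lin_comb_add lin_comb_quad_order flip: of_int_add)

lemma quad_order_diff [intro]: "x \<in> quad_order \<Longrightarrow> y \<in> quad_order \<Longrightarrow> x - y \<in> quad_order"
  by (elim quad_orderE) (simp add: lin_comb_diff lin_comb_quad_order flip: of_int_diff)

lemma quad_order_mult [intro]:
  assumes "x \<in> quad_order" "y \<in> quad_order"
  shows "x * y \<in> quad_order"
proof -
  obtain a b a' b' :: int where "x = lin_comb a b" "y = lin_comb a' b'"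
    using assms by (blast elim: quad_orderE)
  then have "x * y = lin_comb (of_int (a * a' - \<nu> * b * b')) (of_int (a * b' + b * a' + \<tau> * b * b'))"
    by (simp add: lin_comb_mult)
  then show ?thesis
    unfolding quad_order_def by blast
qed

lemma quad_order_cnj [intro]:
  assumes "x \<in> quad_order"
  shows "cnj x \<in> quad_order"
proof -
  obtain a b :: int where "x = lin_comb a b"
    using assms by (blast elim: quad_orderE)
  then have "cnj x = lin_comb (of_int (a + \<tau> * b)) (of_int (- b))"
    by (simp add: cnj_lin_comb)
  then show ?thesis
    unfolding quad_order_def by blast
qed

lemma of_int_quad_order [intro]: "of_int n \<in> quad_order"
  using lin_comb_quad_order[of n 0] by (simp add: lin_comb_def)

lemma quad_order_0 [intro, simp]: "0 \<in> quad_order" and quad_order_1 [intro, simp]: "1 \<in> quad_order"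
  using of_int_quad_order[of 0] of_int_quad_order[of 1] by simp_all

lemma quad_order_power [intro]: "x \<in> quad_order \<Longrightarrow> x ^ n \<in> quad_order"
  by (induction n) auto

lemma quad_order_sum: "(\<And>i. i \<in> I \<Longrightarrow> f i \<in> quad_order) \<Longrightarrow> sum f I \<in> quad_order"
  by (induction I rule: infinite_finite_induct) auto

lemma cmod_square_order:
  assumes "x \<in> quad_order"
  obtains n :: nat where "(cmod x)\<^sup>2 = of_nat n"
proof -
  obtain a b :: int where x: "x = lin_comb a b"
    using assms by (blast elim: quad_orderE)
  then have *: "(cmod x)\<^sup>2 = of_int (a\<^sup>2 + \<tau> * a * b + \<nu> * b\<^sup>2)"
    by (simp add: cmod_lin_comb_square)
  then have "0 \<le> a\<^sup>2 + \<tau> * a * b + \<nu> * b\<^sup>2"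
    by (metis of_int_0_le_iff zero_le_power2)
  with * have "(cmod x)\<^sup>2 = of_nat (nat (a\<^sup>2 + \<tau> * a * b + \<nu> * b\<^sup>2))"
    by simp
  then show thesis
    by (rule that)
qed

lemma quad_order_subset_quad_field: "quad_order \<subseteq> quad_field"
  unfolding quad_order_def quad_field_def using Rats_of_int by blast

section \<open>Euclidean division and reduced fractions\<close>

lemma exists_quad_order_near: "\<exists>\<gamma>\<in>quad_order. cmod (x - \<gamma>) < 1"
proof
  define s t where "s = coord1 x - round (coord1 x)" and "t = coord2 x - round (coord2 x)"
  have st: "\<bar>s\<bar> \<le> 1 / 2" "\<bar>t\<bar> \<le> 1 / 2"
    using of_int_round_abs_le[of "coord1 x"] of_int_round_abs_le[of "coord2 x"]
    by (simp_all add: s_def t_def abs_minus_commute)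
  have half: "\<bar>a * b\<bar> \<le> 1 / 4" if "\<bar>a\<bar> \<le> 1 / 2" "\<bar>b\<bar> \<le> 1 / 2" for a b :: real
    using mult_mono[OF that] by (simp add: abs_mult)
  let ?\<gamma> = "lin_comb (round (coord1 x)) (round (coord2 x))"
  show "?\<gamma> \<in> quad_order"
    by (rule lin_comb_quad_order)
  have "x - ?\<gamma> = lin_comb s t"
    by (subst lin_comb_coord[of x, symmetric]) (simp only: lin_comb_diff s_def t_def)
  then have "(cmod (x - ?\<gamma>))\<^sup>2 = s * s + of_int \<tau> * (s * t) + of_int \<nu> * (t * t)"
    by (simp only: cmod_lin_comb_square) (simp add: power2_eq_square)
  also have "\<dots> \<le> 1 / 4 + of_int \<tau> * (1 / 4) + of_int \<nu> * (1 / 4)"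
    using half[OF st(1) st(1)] half[OF st] half[OF st(2) st(2)] trace_nonneg norm_nonneg
    by (intro add_mono mult_left_mono) (auto dest: abs_le_D1)
  also have "\<dots> < 1"
  proof -
    have "of_int (\<tau> + \<nu>) \<le> (2::real)"
      using trace_plus_norm_le by linarith
    then show ?thesis by simp
  qed
  finally show "cmod (x - ?\<gamma>) < 1"
    by (simp add: power_less_one_iff)
qed

text \<open>After clearing denominators, z = A / B with A and B in the order. A nonzero element of
  least norm in the ideal generated by A and B divides both by Euclidean division, and since it is
  itself a combination of A and B, dividing by it yields the Bezout identity.\<close>

lemma coprime_pair_exists:
  assumes "z \<in> quad_field"
  obtains \<alpha> \<beta> where "coprime_pair \<alpha> \<beta>" "\<beta> \<noteq> 0" "z = \<alpha> / \<beta>"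
proof -
  obtain a b where z: "z = lin_comb a b" and "a \<in> \<rat>" "b \<in> \<rat>"
    using assms unfolding quad_field_def by blast
  then obtain m n m' n' :: int where ab: "a = m / n" "n \<noteq> 0" "b = m' / n'" "n' \<noteq> 0"
    by (metis Rats_cases' less_irrefl)
  define A B where "A = lin_comb (of_int (m * n')) (of_int (m' * n))" and "B = (of_int (n * n') :: complex)"
  have AB: "A \<in> quad_order" "B \<in> quad_order" "B \<noteq> 0"
    using ab lin_comb_quad_order[of "m * n'" "m' * n"] of_int_quad_order[of "n * n'"]
    unfolding A_def B_def by simp_all
  have zAB: "z = A / B"
  proof -
    have "A = B * z"
      using ab by (simp add: z A_def B_def lin_comb_def algebra_simps)
    then show ?thesis
      using AB by simp
  qed
  define I where "I = {u * A + v * B | u v. u \<in> quad_order \<and> v \<in> quad_order}"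
  have I_order: "x \<in> quad_order" if "x \<in> I" for x
    using that AB unfolding I_def by auto
  have "1 * A + 0 * B \<in> I" "0 * A + 1 * B \<in> I"
    unfolding I_def using quad_order_0 quad_order_1 by blast+
  then have "A \<in> I" "B \<in> I"
    by simp_all
  have I_diff: "x - c * y \<in> I" if xy: "x \<in> I" "y \<in> I" and c: "c \<in> quad_order" for x y c
  proof -
    obtain u v u' v' where uv: "x = u * A + v * B" "y = u' * A + v' * B"
        "u \<in> quad_order" "v \<in> quad_order" "u' \<in> quad_order" "v' \<in> quad_order"
      using xy unfolding I_def by blast
    then have "x - c * y = (u - c * u') * A + (v - c * v') * B"
      by (simp add: algebra_simps)
    with uv c show ?thesis
      unfolding I_def by blast
  qed
  \<comment> \<open>On the order this is exactly the norm; the rounding only supplies a total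
    function into the naturals, where a minimum exists.\<close>
  define m where "m = (\<lambda>x. nat \<lfloor>(cmod x)\<^sup>2\<rfloor>)"
  have m: "real (m x) = (cmod x)\<^sup>2" if "x \<in> quad_order" for x
  proof -
    from that obtain n :: nat where "(cmod x)\<^sup>2 = n"
      by (rule cmod_square_order)
    then show ?thesis
      by (simp add: m_def)
  qed
  obtain \<delta> where \<delta>: "\<delta> \<in> I" "\<delta> \<noteq> 0" and least: "\<And>x. x \<in> I \<Longrightarrow> x \<noteq> 0 \<Longrightarrow> m \<delta> \<le> m x"
    using ex_has_least_nat[of "\<lambda>x. x \<in> I \<and> x \<noteq> 0" B m] \<open>B \<in> I\<close> AB by blast
  have div: "x / \<delta> \<in> quad_order" if x: "x \<in> I" for x
  proof -
    obtain \<gamma> where \<gamma>: "\<gamma> \<in> quad_order" "cmod (x / \<delta> - \<gamma>) < 1"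
      using exists_quad_order_near by blast
    have r: "x - \<gamma> * \<delta> \<in> I"
      using I_diff x \<delta> \<gamma> by blast
    have "x - \<gamma> * \<delta> = (x / \<delta> - \<gamma>) * \<delta>"
      using \<delta> by (simp add: field_simps)
    then have "cmod (x - \<gamma> * \<delta>) < cmod \<delta>"
      using \<gamma>(2) \<delta> by (simp add: norm_mult)
    then have "real (m (x - \<gamma> * \<delta>)) < real (m \<delta>)"
      using m[OF I_order[OF r]] m[OF I_order[OF \<delta>(1)]] by (simp add: power_strict_mono)
    then have "x - \<gamma> * \<delta> = 0"
      using least[OF r] by force
    then have "x / \<delta> = \<gamma>"
      using \<delta> by simp
    with \<gamma> show ?thesis by simp
  qed
  obtain u v where uv: "u \<in> quad_order" "v \<in> quad_order" "\<delta> = u * A + v * B"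
    using \<delta> unfolding I_def by blast
  then have "u * (A / \<delta>) + v * (B / \<delta>) = 1"
    using \<delta>(2) by (simp flip: add_divide_distrib)
  then have "coprime_pair (A / \<delta>) (B / \<delta>)"
    unfolding coprime_pair_def using uv div \<open>A \<in> I\<close> \<open>B \<in> I\<close> by blast
  moreover have "B / \<delta> \<noteq> 0" "z = (A / \<delta>) / (B / \<delta>)"
    using \<delta> AB zAB by auto
  ultimately show thesis
    by (rule that)
qed

section \<open>The ring of integers and the height on the field\<close>

lemma coprime_pair_power:
  assumes "coprime_pair \<alpha> \<beta>"
  shows "coprime_pair (\<alpha> ^ n) \<beta>"
proof (induction n)
  case 0
  then show ?case
    using assms unfolding coprime_pair_def by (force intro: bexI[of _ 1] bexI[of _ 0])
next
  case (Suc n)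
  obtain u v u' v' where *: "u \<in> quad_order" "v \<in> quad_order" "u' \<in> quad_order" "v' \<in> quad_order"
      "u * \<alpha> ^ n + v * \<beta> = 1" "u' * \<alpha> + v' * \<beta> = 1" and ab: "\<alpha> \<in> quad_order" "\<beta> \<in> quad_order"
    using assms Suc unfolding coprime_pair_def by blast
  have "(u * \<alpha> ^ n + v * \<beta>) * (u' * \<alpha> + v' * \<beta>) = 1"
    using * by simp
  then have "(u * u') * \<alpha> ^ Suc n + (u * \<alpha> ^ n * v' + v * u' * \<alpha> + v * v' * \<beta>) * \<beta> = 1"
    by (simp add: algebra_simps)
  moreover have "u * u' \<in> quad_order" "u * \<alpha> ^ n * v' + v * u' * \<alpha> + v * v' * \<beta> \<in> quad_order"
    using * ab by blast+
  ultimately show ?case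
    unfolding coprime_pair_def using ab by blast
qed

text \<open>The rational root argument: multiplying the monic integral equation by beta^n gives
  alpha^n = - R beta. As alpha^n remains coprime to beta, beta is a unit, so alpha / beta lies in
  the order.\<close>

lemma algebraic_int_in_quad_order:
  assumes "z \<in> quad_field" "algebraic_int z"
  shows "z \<in> quad_order"
proof -
  obtain \<alpha> \<beta> where ab: "coprime_pair \<alpha> \<beta>" "\<beta> \<noteq> 0" "z = \<alpha> / \<beta>"
    using coprime_pair_exists assms(1) by blast
  obtain p where p: "lead_coeff p = 1" "\<forall>i. coeff p i \<in> \<int>" "poly p z = 0"
    using assms(2) by (auto elim: algebraic_int.cases)
  define n where "n = degree p"
  have coeff_order: "coeff p i \<in> quad_order" for i
    using p(2) by (auto elim!: allE[of _ i] Ints_cases)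
  have order: "\<alpha> \<in> quad_order" "\<beta> \<in> quad_order"
    using ab by (simp_all add: coprime_pair_def)
  define R where "R = (\<Sum>i<n. coeff p i * \<alpha> ^ i * \<beta> ^ (n - 1 - i))"
  have "R \<in> quad_order"
    unfolding R_def by (intro quad_order_sum quad_order_mult quad_order_power coeff_order order)
  have "0 = \<beta> ^ n * poly p z"
    using p by simp
  also have "\<dots> = (\<Sum>i\<le>n. \<beta> ^ n * (coeff p i * z ^ i))"
    by (simp add: poly_altdef n_def sum_distrib_left)
  also have "\<dots> = (\<Sum>i<n. \<beta> ^ n * (coeff p i * z ^ i)) + \<beta> ^ n * z ^ n"
    using p(1) by (simp add: n_def flip: lessThan_Suc_atMost)
  also have "(\<Sum>i<n. \<beta> ^ n * (coeff p i * z ^ i)) = R * \<beta>"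
    unfolding R_def sum_distrib_right
  proof (rule sum.cong)
    fix i assume "i \<in> {..<n}"
    then have "n = i + (n - 1 - i) + 1"
      by auto
    then have "\<beta> ^ n = \<beta> ^ i * \<beta> ^ (n - 1 - i) * \<beta>"
      by (metis power_add power_one_right)
    then show "\<beta> ^ n * (coeff p i * z ^ i) = coeff p i * \<alpha> ^ i * \<beta> ^ (n - 1 - i) * \<beta>"
      using ab by (simp add: power_divide)
  qed simp
  also have "\<beta> ^ n * z ^ n = \<alpha> ^ n"
    using ab by (simp add: power_divide)
  finally have *: "\<alpha> ^ n = - R * \<beta>"
    by (simp add: eq_neg_iff_add_eq_0 add.commute)
  obtain u v where uv: "u \<in> quad_order" "v \<in> quad_order" "u * \<alpha> ^ n + v * \<beta> = 1"
    using coprime_pair_power[OF ab(1), of n] unfolding coprime_pair_def by blast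
  then have "(v - u * R) * \<beta> = 1"
    by (simp add: * algebra_simps)
  then have "1 / \<beta> = v - u * R"
    using ab(2) by (simp add: divide_eq_eq)
  then have "z = \<alpha> * (v - u * R)"
    using ab(3) by (simp add: divide_inverse)
  with uv order \<open>R \<in> quad_order\<close> show ?thesis
    by auto
qed

text \<open>Trace and norm of z are integers, and z is a root of X^2 - trace X + norm.\<close>

lemma algebraic_int_of_quad_order:
  assumes "z \<in> quad_order"
  shows "algebraic_int z"
proof -
  obtain a b :: int where z: "z = lin_comb a b"
    using assms by (blast elim: quad_orderE)
  have cnj: "z + cnj z = of_int (2 * a + \<tau> * b)" "z * cnj z = of_int (a\<^sup>2 + \<tau> * a * b + \<nu> * b\<^sup>2)"
  proof -
    show "z + cnj z = of_int (2 * a + \<tau> * b)"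
      by (simp add: z cnj_lin_comb lin_comb_add) (simp add: lin_comb_def)
    show "z * cnj z = of_int (a\<^sup>2 + \<tau> * a * b + \<nu> * b\<^sup>2)"
      by (simp add: z cmod_lin_comb_square flip: complex_norm_square)
  qed
  show ?thesis
  proof (rule algebraic_int.intros)
    let ?p = "[:z * cnj z, - (z + cnj z), 1:]"
    show "lead_coeff ?p = 1" "poly ?p z = 0"
      by (simp_all add: algebra_simps)
    show "\<forall>i. coeff ?p i \<in> \<int>"
      unfolding cnj by (auto simp: coeff_pCons split: nat.splits)
  qed
qed

lemma ring_of_integers_quad_field: "ring_of_integers quad_field = quad_order"
  using algebraic_int_in_quad_order algebraic_int_of_quad_order quad_order_subset_quad_field
  by (auto simp: ring_of_integers_def)

text \<open>Multiplying u alpha + v beta = 1 by another reduced denominator beta' shows that beta' =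
  w beta with w in the order. The norm of w is a positive integer, so |beta| <= |beta'|, and
  symmetry gives equality.\<close>

lemma field_height_eq:
  assumes "coprime_pair \<alpha> \<beta>" "\<beta> \<noteq> 0"
  shows "field_height quad_field (\<alpha> / \<beta>) = (cmod \<beta>)\<^sup>2"
proof -
  have le: "cmod \<beta> \<le> cmod \<beta>'"
    if *: "coprime_pair \<alpha> \<beta>" "coprime_pair \<alpha>' \<beta>'" "\<beta> \<noteq> 0" "\<beta>' \<noteq> 0" "\<alpha> / \<beta> = \<alpha>' / \<beta>'" for \<alpha> \<beta> \<alpha>' \<beta>'
  proof -
    obtain u v where uv: "u \<in> quad_order" "v \<in> quad_order" "u * \<alpha> + v * \<beta> = 1"
      using * unfolding coprime_pair_def by blast
    define w where "w = u * \<alpha>' + v * \<beta>'"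
    have "w \<in> quad_order"
      using uv * unfolding w_def coprime_pair_def by blast
    have "\<beta>' = (u * \<alpha> + v * \<beta>) * \<beta>'"
      using uv by simp
    also have "\<dots> = w * \<beta>"
      using * by (simp add: w_def field_simps)
    finally have w: "\<beta>' = w * \<beta>" .
    obtain n where n: "(cmod w)\<^sup>2 = of_nat n"
      using cmod_square_order \<open>w \<in> quad_order\<close> by blast
    have "w \<noteq> 0"
      using w * by auto
    with n have "1 \<le> (cmod w)\<^sup>2"
      by (cases n) auto
    then have "1 \<le> cmod w"
      by (intro power2_le_imp_le[of 1]) simp_all
    then show ?thesis
      using mult_right_mono[of 1 "cmod w" "cmod \<beta>"] by (simp add: w norm_mult)
  qed
  show ?thesis
    unfolding field_height_def ring_of_integers_quad_field
  proof (rule the_equality)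
    show "\<exists>\<alpha>'\<in>quad_order. \<exists>\<beta>'\<in>quad_order. (\<exists>u\<in>quad_order. \<exists>v\<in>quad_order. u * \<alpha>' + v * \<beta>' = 1) \<and>
        \<beta>' \<noteq> 0 \<and> \<alpha> / \<beta> = \<alpha>' / \<beta>' \<and> (cmod \<beta>)\<^sup>2 = (cmod \<beta>')\<^sup>2"
      using assms unfolding coprime_pair_def by blast
    fix h assume "\<exists>\<alpha>'\<in>quad_order. \<exists>\<beta>'\<in>quad_order. (\<exists>u\<in>quad_order. \<exists>v\<in>quad_order. u * \<alpha>' + v * \<beta>' = 1) \<and>
        \<beta>' \<noteq> 0 \<and> \<alpha> / \<beta> = \<alpha>' / \<beta>' \<and> h = (cmod \<beta>')\<^sup>2"
    then obtain \<alpha>' \<beta>' where *: "coprime_pair \<alpha>' \<beta>'" "\<beta>' \<noteq> 0" "\<alpha> / \<beta> = \<alpha>' / \<beta>'" "h = (cmod \<beta>')\<^sup>2"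
      unfolding coprime_pair_def by blast
    have "cmod \<beta> = cmod \<beta>'"
      using le[OF assms(1) *(1) assms(2) *(2,3)] le[OF *(1) assms(1) *(2) assms(2) *(3)[symmetric]] by simp
    then show "h = (cmod \<beta>)\<^sup>2"
      using * by simp
  qed
qed

text \<open>The last equation expands \<open>\<bar>u \<alpha> + v \<beta>\<bar>\<^sup>2 = 1\<close>, where \<open>u * cnj v = g + h \<theta>\<close>. It certifies
  coprimality in a form that is linear in \<open>a\<close>, \<open>c\<close>, \<open>s\<close>, \<open>t\<close>.\<close>
lemma coprime_pair_hermitian:
  assumes "coprime_pair \<alpha> \<beta>" "\<beta> \<noteq> 0"
  obtains a c s t A B g h :: int
  where "0 < c" "(cmod \<beta>)\<^sup>2 = of_int c" "\<alpha> / \<beta> = lin_comb (s / c) (t / c)"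
    "a * c = s\<^sup>2 + \<tau> * s * t + \<nu> * t\<^sup>2"
    "A * a + B * c + 2 * g * s + \<tau> * (g * t + h * s) + (\<tau>\<^sup>2 - 2 * \<nu>) * h * t = 1"
proof -
  obtain u v where order: "\<alpha> \<in> quad_order" "\<beta> \<in> quad_order" "u \<in> quad_order" "v \<in> quad_order"
      and uv: "u * \<alpha> + v * \<beta> = 1"
    using assms unfolding coprime_pair_def by blast
  have "\<alpha> * cnj \<beta> \<in> quad_order" "u * cnj v \<in> quad_order"
    using order by blast+
  then obtain s t g h :: int where st: "\<alpha> * cnj \<beta> = lin_comb s t" and gh: "u * cnj v = lin_comb g h"
    by (metis quad_orderE)
  obtain a c :: nat where "(cmod \<alpha>)\<^sup>2 = a" "(cmod \<beta>)\<^sup>2 = c"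
    using order(1,2) by (blast elim: cmod_square_order)
  moreover obtain A B :: nat where "(cmod u)\<^sup>2 = A" "(cmod v)\<^sup>2 = B"
    using order(3,4) by (blast elim: cmod_square_order)
  ultimately have ac: "(cmod \<alpha>)\<^sup>2 = a" "(cmod \<beta>)\<^sup>2 = c" "(cmod u)\<^sup>2 = A" "(cmod v)\<^sup>2 = B"
    by simp_all
  have "c \<noteq> 0"
    using ac(2) assms(2) by (intro notI) simp
  have "of_nat (a * c) = (cmod (\<alpha> * cnj \<beta>))\<^sup>2"
    by (simp add: ac norm_mult power_mult_distrib)
  also have "\<dots> = real_of_int (s\<^sup>2 + \<tau> * s * t + \<nu> * t\<^sup>2)"
    by (simp add: st cmod_lin_comb_square)
  finally have "real_of_int (int a * int c) = real_of_int (s\<^sup>2 + \<tau> * s * t + \<nu> * t\<^sup>2)"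
    by simp
  then have disc: "int a * int c = s\<^sup>2 + \<tau> * s * t + \<nu> * t\<^sup>2"
    by (simp only: of_int_eq_iff)
  have "1 = (cmod (u * \<alpha> + v * \<beta>))\<^sup>2"
    by (simp add: uv)
  also have "\<dots> = (cmod u)\<^sup>2 * (cmod \<alpha>)\<^sup>2 + (cmod v)\<^sup>2 * (cmod \<beta>)\<^sup>2 + 2 * Re ((u * cnj v) * (\<alpha> * cnj \<beta>))"
    unfolding cmod_power2 by (simp add: power2_eq_square algebra_simps)
  also have "\<dots> = real_of_int (int A * int a + int B * int c + 2 * g * s + \<tau> * (g * t + h * s) + (\<tau>\<^sup>2 - 2 * \<nu>) * h * t)"
    unfolding ac st gh lin_comb_mult Re_lin_comb by (simp add: algebra_simps power2_eq_square)
  finally have "int A * int a + int B * int c + 2 * g * s + \<tau> * (g * t + h * s) + (\<tau>\<^sup>2 - 2 * \<nu>) * h * t = 1"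
    by (metis of_int_eq_1_iff)
  moreover have "\<alpha> / \<beta> = lin_comb (s / c) (t / c)"
  proof -
    have "\<alpha> / \<beta> = of_real (1 / c) * (\<alpha> * cnj \<beta>)"
      unfolding complex_div_cnj[of \<alpha> \<beta>] ac(2) by simp
    then show ?thesis
      unfolding st of_real_mult_lin_comb by simp
  qed
  ultimately show thesis
    using that[of "int c" s t "int a"] disc ac \<open>c \<noteq> 0\<close> by simp
qed

section \<open>Finiteness of points of bounded height\<close>

lemma finite_quad_order_bounded: "finite {x \<in> quad_order. cmod x \<le> R}"
proof -
  \<comment> \<open>The imaginary part b Im(theta) bounds b by T; then the real part a + b tau / 2
    bounds a by S.\<close>
  define T where "T = R / Im \<theta>"
  define S where "S = R + T * of_int \<tau>"
  have "{x \<in> quad_order. cmod x \<le> R} \<subseteq>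
      (\<lambda>(a, b). lin_comb (of_int a) (of_int b)) ` ({-\<lceil>S\<rceil>..\<lceil>S\<rceil>} \<times> {-\<lceil>T\<rceil>..\<lceil>T\<rceil>})"
  proof safe
    fix x assume x: "x \<in> quad_order" "cmod x \<le> R"
    then obtain a b :: int where ab: "x = lin_comb a b"
      by (blast elim: quad_orderE)
    have "\<bar>of_int b * Im \<theta>\<bar> \<le> R"
      using abs_Im_le_cmod[of x] x by (simp add: ab Im_lin_comb)
    then have b: "\<bar>of_int b\<bar> \<le> T"
      using Im_theta_pos by (simp add: T_def abs_mult field_simps)
    have "\<bar>of_int a + of_int b * of_int \<tau> / 2\<bar> \<le> R"
      using abs_Re_le_cmod[of x] x by (simp add: ab Re_lin_comb)
    moreover have "\<bar>of_int b * real_of_int \<tau> / 2\<bar> \<le> T * of_int \<tau>"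
    proof -
      have "\<bar>of_int b * real_of_int \<tau>\<bar> \<le> T * of_int \<tau>"
        using b trace_nonneg by (auto simp: abs_mult intro: mult_right_mono)
      then show ?thesis
        by linarith
    qed
    ultimately have "\<bar>of_int a\<bar> \<le> S"
      unfolding S_def by linarith
    with b have "a \<in> {-\<lceil>S\<rceil>..\<lceil>S\<rceil>}" "b \<in> {-\<lceil>T\<rceil>..\<lceil>T\<rceil>}"
      unfolding atLeastAtMost_iff by linarith+
    then have "(a, b) \<in> {-\<lceil>S\<rceil>..\<lceil>S\<rceil>} \<times> {-\<lceil>T\<rceil>..\<lceil>T\<rceil>}"
      by blast
    then show "x \<in> (\<lambda>(a, b). lin_comb (of_int a) (of_int b)) ` ({-\<lceil>S\<rceil>..\<lceil>S\<rceil>} \<times> {-\<lceil>T\<rceil>..\<lceil>T\<rceil>})"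
      unfolding ab by (rule rev_image_eqI) simp
  qed
  then show ?thesis
    by (rule finite_subset) auto
qed

lemma field_height_ge_1:
  assumes "z \<in> quad_field"
  shows "1 \<le> field_height quad_field z"
proof -
  obtain \<alpha> \<beta> where *: "coprime_pair \<alpha> \<beta>" "\<beta> \<noteq> 0" "z = \<alpha> / \<beta>"
    using coprime_pair_exists assms by blast
  obtain n where "(cmod \<beta>)\<^sup>2 = of_nat n"
    using * cmod_square_order unfolding coprime_pair_def by blast
  with * show ?thesis
    by (cases n) (auto simp: field_height_eq)
qed

text \<open>The Northcott property for bounded z: numerator and denominator both range over bounded,
  hence finite, subsets of the order.\<close>

lemma finite_field_height_bounded:
  "finite {z \<in> quad_field. cmod z \<le> R \<and> field_height quad_field z \<le> M}"
proof -
  define B where "B = {x \<in> quad_order. cmod x \<le> sqrt M}"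
  define A where "A = {x \<in> quad_order. cmod x \<le> R * sqrt M}"
  have "{z \<in> quad_field. cmod z \<le> R \<and> field_height quad_field z \<le> M} \<subseteq> (\<lambda>(x, y). x / y) ` (A \<times> B)"
  proof safe
    fix z assume z: "z \<in> quad_field" "cmod z \<le> R" "field_height quad_field z \<le> M"
    obtain \<alpha> \<beta> where *: "coprime_pair \<alpha> \<beta>" "\<beta> \<noteq> 0" "z = \<alpha> / \<beta>"
      using coprime_pair_exists z(1) by blast
    have "(cmod \<beta>)\<^sup>2 \<le> M"
      using z * by (simp add: field_height_eq)
    then have \<beta>: "cmod \<beta> \<le> sqrt M"
      by (rule real_le_rsqrt)
    have "cmod \<alpha> = cmod z * cmod \<beta>"
      using * by (simp add: norm_divide)
    also have "\<dots> \<le> R * sqrt M"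
      using z(2) \<beta> by (intro mult_mono) (auto intro: order_trans[OF norm_ge_zero])
    finally have "\<alpha> \<in> A" "\<beta> \<in> B"
      using * \<beta> unfolding A_def B_def coprime_pair_def by auto
    then show "z \<in> (\<lambda>(x, y). x / y) ` (A \<times> B)"
      using * by force
  qed
  moreover have "finite (A \<times> B)"
    unfolding A_def B_def by (intro finite_cartesian_product finite_quad_order_bounded)
  ultimately show ?thesis
    by (auto intro: finite_subset)
qed

text \<open>Both factors are bounded: the height is at least 1, which bounds the distance by B, and
  the distance is at least delta, which bounds the height by B / delta.\<close>

lemma finite_far_small_height_times_dist:
  assumes "0 < \<delta>"
  shows "finite {z \<in> quad_field. \<delta> \<le> dist \<xi> z \<and> field_height quad_field z * dist \<xi> z \<le> B}"
proof (rule finite_subset)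
  show "{z \<in> quad_field. \<delta> \<le> dist \<xi> z \<and> field_height quad_field z * dist \<xi> z \<le> B} \<subseteq>
      {z \<in> quad_field. cmod z \<le> cmod \<xi> + B \<and> field_height quad_field z \<le> B / \<delta>}"
  proof safe
    fix z assume z: "z \<in> quad_field" "\<delta> \<le> dist \<xi> z" "field_height quad_field z * dist \<xi> z \<le> B"
    have h: "1 \<le> field_height quad_field z"
      using field_height_ge_1 z(1) .
    have "dist \<xi> z \<le> B"
      using mult_right_mono[OF h, of "dist \<xi> z"] z(3) by simp
    then show "cmod z \<le> cmod \<xi> + B"
      using norm_triangle_ineq3[of \<xi> z] by (simp add: dist_norm)
    have "field_height quad_field z * \<delta> \<le> B"
      using mult_left_mono[OF z(2), of "field_height quad_field z"] h z(3) by linarith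
    then show "field_height quad_field z \<le> B / \<delta>"
      using assms by (simp add: field_simps)
  qed
qed (rule finite_field_height_bounded)

text \<open>The common part of the three cases. (P, N) is the cone point over s + t theta whose
  coefficient c is 1, and kappa is the squared norm of the points of the sphere. The assumption
  \<open>primitive\<close> is the arithmetic input: it converts the integral Bezout certificate of a
  reduced fraction into a primitive vector, obtained by scaling (P, N) by c = |beta|^2.\<close>

theorem lagrange_number_parametrization:
  fixes P :: "real \<Rightarrow> real \<Rightarrow> real^'n" and N :: "real \<Rightarrow> real \<Rightarrow> real" and \<kappa> :: real
    and S :: "(real^'n) set"
  assumes n: "n \<in> S \<inter> rational_points"
    and cont_P: "continuous_on UNIV (\<lambda>x. P (fst x) (snd x))"
    and cont_N: "continuous_on UNIV (\<lambda>x. N (fst x) (snd x))"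
    and N_ge: "\<And>s t. 1 / 4 \<le> N s t"
    and inner: "\<And>s t s' t'. P s t \<bullet> P s' t' = \<kappa> * N s t * N s' t' -
      ((s - s')\<^sup>2 + of_int \<tau> * (s - s') * (t - t') + of_int \<nu> * (t - t')\<^sup>2)"
    and into: "\<And>s t. P s t /\<^sub>R N s t \<in> S - {n}"
    and onto: "\<And>x. x \<in> S - {n} \<Longrightarrow>
      \<exists>s t. x = P s t /\<^sub>R N s t \<and> (x \<in> rational_points \<longrightarrow> s \<in> \<rat> \<and> t \<in> \<rat>)"
    and primitive: "\<And>a c s t A B g h :: int. 0 < c \<Longrightarrow> a * c = s\<^sup>2 + \<tau> * s * t + \<nu> * t\<^sup>2 \<Longrightarrow>
      A * a + B * c + 2 * g * s + \<tau> * (g * t + h * s) + (\<tau>\<^sup>2 - 2 * \<nu>) * h * t = 1 \<Longrightarrow>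
      \<exists>(p :: int^'n) q. Gcd (range (\<lambda>i. p $ i)) = 1 \<and> of_int q = of_int c * N (s / c) (t / c) \<and>
        (\<forall>i. of_int (p $ i) = of_int c * P (s / c) (t / c) $ i)"
  shows "\<exists>(n :: real^'n) (\<Phi> :: complex \<Rightarrow> real^'n).
       n \<in> S \<inter> rational_points \<and>
       continuous_on UNIV \<Phi> \<and> bij_betw \<Phi> UNIV (S - {n}) \<and>
       \<Phi> ` quad_field = (S \<inter> rational_points) - {n} \<and>
       (\<forall>\<xi>. \<xi> \<notin> quad_field \<longrightarrow>
          lagrange_number quad_field (field_height quad_field) \<xi> =
          ennreal (sqrt 2) * lagrange_number (S \<inter> rational_points) rational_height (\<Phi> \<xi>))"
proof -
  define M where "M = (\<lambda>z. N (coord1 z) (coord2 z))"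
  define \<Phi> where "\<Phi> = (\<lambda>z. P (coord1 z) (coord2 z) /\<^sub>R M z)"
  have M_ge: "1 / 4 \<le> M z" for z
    using N_ge by (simp add: M_def)
  then have M_pos: "0 < M z" for z
    by (rule less_le_trans[rotated]) simp
  have coord_cont: "continuous_on UNIV (\<lambda>z. (coord1 z, coord2 z))"
    unfolding coord1_def coord2_def using Im_theta_pos by (intro continuous_intros) auto
  have cont_M: "continuous_on UNIV M"
    using continuous_on_compose2[OF cont_N coord_cont] by (simp add: M_def)
  have cont_\<Phi>: "continuous_on UNIV \<Phi>"
    unfolding \<Phi>_def using continuous_on_compose2[OF cont_P coord_cont] cont_M M_pos
    by (intro continuous_intros) (auto simp: less_imp_neq[symmetric])
  have dist_\<Phi>: "dist (\<Phi> z) (\<Phi> w) = sqrt 2 * dist z w / sqrt (M z * M w)" for z w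
  proof (rule power2_eq_imp_eq)
    define x y where "x = P (coord1 z) (coord2 z)" and "y = P (coord1 w) (coord2 w)"
    have "z - w = lin_comb (coord1 z - coord1 w) (coord2 z - coord2 w)"
      by (simp flip: lin_comb_diff)
    then have xy: "x \<bullet> y = \<kappa> * M z * M w - (dist z w)\<^sup>2"
      by (simp add: x_def y_def inner M_def dist_norm cmod_lin_comb_square)
    \<comment> \<open>On the diagonal the error term of \<open>inner\<close> vanishes, so both
      points have squared norm kappa after division by M; kappa then drops out of the squared
      distance.\<close>
    have xx: "x \<bullet> x = \<kappa> * (M z)\<^sup>2" "y \<bullet> y = \<kappa> * (M w)\<^sup>2"
      by (simp_all add: x_def y_def inner M_def power2_eq_square)
    have "(dist (\<Phi> z) (\<Phi> w))\<^sup>2 = (x /\<^sub>R M z - y /\<^sub>R M w) \<bullet> (x /\<^sub>R M z - y /\<^sub>R M w)"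
      by (simp add: dist_norm power2_norm_eq_inner \<Phi>_def x_def y_def)
    also have "\<dots> = x \<bullet> x / (M z)\<^sup>2 - 2 * (x \<bullet> y) / (M z * M w) + y \<bullet> y / (M w)\<^sup>2"
      using M_pos[of z] M_pos[of w]
      by (simp add: inner_diff_left inner_diff_right inner_commute power2_eq_square field_simps)
    also have "\<dots> = 2 * (dist z w)\<^sup>2 / (M z * M w)"
      using M_pos[of z] M_pos[of w] unfolding xy xx by (simp add: field_simps power2_eq_square)
    also have "\<dots> = (sqrt 2 * dist z w / sqrt (M z * M w))\<^sup>2"
      using M_pos[of z] M_pos[of w] by (simp add: power_divide power_mult_distrib)
    finally show "(dist (\<Phi> z) (\<Phi> w))\<^sup>2 = (sqrt 2 * dist z w / sqrt (M z * M w))\<^sup>2" .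
  qed (use M_pos[of z] M_pos[of w] in auto)
  \<comment> \<open>The distance formula separates points, so no inverse map has to be computed for
    injectivity.\<close>
  have inj: "inj \<Phi>"
  proof (rule injI)
    fix z w assume "\<Phi> z = \<Phi> w"
    then have "sqrt 2 * dist z w / sqrt (M z * M w) = 0"
      using dist_\<Phi>[of z w] by simp
    then show "z = w"
      using M_pos[of z] M_pos[of w] by simp
  qed
  have \<Phi>_lin_comb: "\<Phi> (lin_comb s t) = P s t /\<^sub>R N s t" for s t
    by (simp add: \<Phi>_def M_def)
  have \<Phi>_in: "\<Phi> z \<in> S - {n}" for z
    using into by (simp add: \<Phi>_def M_def)
  have height: "\<Phi> z \<in> rational_points \<and> rational_height (\<Phi> z) = field_height quad_field z * M z"
    if z: "z \<in> quad_field" for z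
  proof -
    obtain \<alpha> \<beta> where *: "coprime_pair \<alpha> \<beta>" "\<beta> \<noteq> 0" "z = \<alpha> / \<beta>"
      using coprime_pair_exists z by blast
    obtain a c s t A B g h :: int where **: "0 < c" "(cmod \<beta>)\<^sup>2 = of_int c"
        "\<alpha> / \<beta> = lin_comb (s / c) (t / c)" "a * c = s\<^sup>2 + \<tau> * s * t + \<nu> * t\<^sup>2"
        "A * a + B * c + 2 * g * s + \<tau> * (g * t + h * s) + (\<tau>\<^sup>2 - 2 * \<nu>) * h * t = 1"
      using coprime_pair_hermitian[OF *(1,2)] .
    obtain p :: "int^'n" and q where p: "Gcd (range (\<lambda>i. p $ i)) = 1" "of_int q = of_int c * N (s / c) (t / c)"
        "\<And>i. of_int (p $ i) = of_int c * P (s / c) (t / c) $ i"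
      using primitive[OF **(1,4,5)] by blast
    have zl: "z = lin_comb (s / c) (t / c)"
      using * ** by simp
    have M: "M z = N (s / c) (t / c)"
      by (simp add: zl M_def)
    have q: "of_int q = of_int c * M z"
      by (simp add: M p)
    have "0 < real_of_int q"
      unfolding q using **(1) M_pos[of z] by simp
    then have "0 < q"
      by simp
    have \<Phi>: "\<Phi> z = (\<chi> i. of_int (p $ i) / of_int q)"
      unfolding zl \<Phi>_lin_comb vec_eq_iff using **(1) by (simp add: p divide_inverse)
    then have "rational_height (\<Phi> z) = of_int q"
      using rational_height_eq[OF p(1), of q] \<open>0 < q\<close> by simp
    moreover have "\<Phi> z \<in> rational_points"
      unfolding \<Phi> rational_points_def by simp
    ultimately show ?thesis
      using field_height_eq[OF *(1,2)] **(2) q unfolding *(3)[symmetric] by simp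
  qed
  have range: "range \<Phi> = S - {n}"
    using \<Phi>_in onto \<Phi>_lin_comb by (metis (no_types, lifting) image_subset_iff subsetI subset_antisym rangeI)
  have image: "\<Phi> ` quad_field = S \<inter> rational_points - {n}"
  proof (intro equalityI subsetI)
    fix x assume "x \<in> \<Phi> ` quad_field"
    then show "x \<in> S \<inter> rational_points - {n}"
      using \<Phi>_in height by auto
  next
    fix x assume x: "x \<in> S \<inter> rational_points - {n}"
    then obtain s t where "x = P s t /\<^sub>R N s t" "s \<in> \<rat>" "t \<in> \<rat>"
      using onto[of x] by blast
    then show "x \<in> \<Phi> ` quad_field"
      unfolding quad_field_def \<Phi>_lin_comb[symmetric] by blast
  qed
  have lagrange: "lagrange_number quad_field (field_height quad_field) \<xi> =
      ennreal (sqrt 2) * lagrange_number (S \<inter> rational_points) rational_height (\<Phi> \<xi>)"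
    if \<xi>: "\<xi> \<notin> quad_field" for \<xi>
  proof -
    \<comment> \<open>The ratio between the two approximation quantities once sqrt 2 is absorbed: g
      = f rho, with rho continuous and equal to 1 at xi.\<close>
    define \<rho> where "\<rho> = (\<lambda>z. sqrt (M z / M \<xi>))"
    define f where "f = (\<lambda>z. field_height quad_field z * dist \<xi> z)"
    define g where "g = (\<lambda>z. rational_height (\<Phi> z) / sqrt 2 * dist (\<Phi> \<xi>) (\<Phi> z))"
    have \<rho>_pos: "0 < \<rho> z" for z
      using M_pos by (simp add: \<rho>_def)
    have g_eq: "g z = f z * \<rho> z" if "z \<in> quad_field" for z
    proof -
      have "g z = field_height quad_field z * dist \<xi> z * (M z / sqrt (M \<xi> * M z))"
        using height[OF that] by (simp add: g_def dist_\<Phi>)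
      also have "M z / sqrt (M \<xi> * M z) = \<rho> z"
        using M_pos[of z] M_pos[of \<xi>] by (simp add: \<rho>_def real_sqrt_mult real_sqrt_divide field_simps)
      finally show ?thesis
        by (simp add: f_def)
    qed
    have f_pos: "0 < f z" if "z \<in> quad_field" for z
      using field_height_ge_1[OF that] \<xi> that by (auto simp: f_def intro!: mult_pos_pos)
    have g_pos: "0 < g z" if "z \<in> quad_field" for z
      using f_pos[OF that] \<rho>_pos by (simp add: g_eq[OF that])
    have "isCont \<rho> \<xi>"
      unfolding \<rho>_def using cont_M M_pos[of \<xi>]
      by (intro continuous_intros) (auto simp: continuous_on_eq_continuous_at)
    then have near: "\<exists>\<delta>>0. \<forall>z. dist \<xi> z < \<delta> \<longrightarrow> \<bar>\<rho> z - 1\<bar> < e" if "0 < e" for e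
      using that M_pos[of \<xi>] unfolding continuous_at_eps_delta
      by (auto simp: \<rho>_def dist_real_def dist_commute)
    have "finite {z \<in> quad_field. f z \<le> B \<and> (1 + e) * f z < g z}" if "0 < e" for e B
    proof -
      obtain \<delta> where \<delta>: "0 < \<delta>" "\<And>z. dist \<xi> z < \<delta> \<Longrightarrow> \<bar>\<rho> z - 1\<bar> < e"
        using near[OF \<open>0 < e\<close>] by blast
      have "{z \<in> quad_field. f z \<le> B \<and> (1 + e) * f z < g z} \<subseteq> {z \<in> quad_field. \<delta> \<le> dist \<xi> z \<and> f z \<le> B}"
      proof safe
        fix z assume z: "z \<in> quad_field" "(1 + e) * f z < g z"
        have "1 + e < \<rho> z"
          using z f_pos[of z] by (simp add: g_eq mult.commute)
        then show "\<delta> \<le> dist \<xi> z"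
          using \<delta>(2)[of z] by force
      qed
      then show ?thesis
        using finite_far_small_height_times_dist[OF \<delta>(1), of \<xi> B] unfolding f_def by (rule finite_subset)
    qed
    moreover have "finite {z \<in> quad_field. g z \<le> B \<and> (1 + e) * g z < f z}" if "0 < e" for e B
    proof -
      \<comment> \<open>A bound on g has to become a bound on f. The uniform lower bound 1/4 for N
        keeps rho above the positive constant r, so f <= B / r.\<close>
      define r where "r = sqrt (1 / 4 / M \<xi>)"
      have r: "0 < r" "r \<le> \<rho> z" for z
        using M_pos[of \<xi>] M_ge[of z] by (auto simp: r_def \<rho>_def field_simps)
      \<comment> \<open>1 / (1 + e) = 1 - e / (1 + e) is the value below which rho has to fall for
        (1 + e) g < f.\<close>
      obtain \<delta> where \<delta>: "0 < \<delta>" "\<And>z. dist \<xi> z < \<delta> \<Longrightarrow> \<bar>\<rho> z - 1\<bar> < e / (1 + e)"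
        using near[of "e / (1 + e)"] \<open>0 < e\<close> by auto
      have "{z \<in> quad_field. g z \<le> B \<and> (1 + e) * g z < f z} \<subseteq> {z \<in> quad_field. \<delta> \<le> dist \<xi> z \<and> f z \<le> B / r}"
      proof safe
        fix z assume z: "z \<in> quad_field" "g z \<le> B" "(1 + e) * g z < f z"
        have "f z * r \<le> g z"
          unfolding g_eq[OF z(1)] using f_pos[OF z(1)] r by (intro mult_left_mono) auto
        then show "f z \<le> B / r"
          using r z(2) by (simp add: field_simps)
        have "f z * ((1 + e) * \<rho> z) < f z * 1"
          using z by (simp add: g_eq mult_ac)
        then have "(1 + e) * \<rho> z < 1"
          using f_pos[OF z(1)] by (simp only: mult_less_cancel_left_pos)
        then have "\<rho> z - 1 < - (e / (1 + e))"
          using \<open>0 < e\<close> by (simp add: field_simps)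
        then show "\<delta> \<le> dist \<xi> z"
          using \<delta>(2)[of z] by force
      qed
      then show ?thesis
        using finite_far_small_height_times_dist[OF \<delta>(1), of \<xi> "B / r"] unfolding f_def by (rule finite_subset)
    qed
    ultimately have "Inf {c. finite {z \<in> quad_field. c < 1 / ennreal (f z)}} =
        Inf {c. finite {z \<in> quad_field. c < 1 / ennreal (g z)}}"
      using f_pos g_pos by (intro antisym Inf_finite_reciprocal_le) auto
    also have "\<dots> = lagrange_number (insert n (\<Phi> ` quad_field)) (\<lambda>x. rational_height x / sqrt 2) (\<Phi> \<xi>)"
      unfolding g_def by (rule lagrange_number_insert_image[symmetric]) (use inj in \<open>auto intro: inj_on_subset\<close>)
    also have "insert n (\<Phi> ` quad_field) = S \<inter> rational_points"
      using n image by auto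
    finally show ?thesis
      by (simp add: cmult_lagrange_number lagrange_number_eq_Inf[of quad_field] f_def)
  qed
  show ?thesis
    using n cont_\<Phi> inj range image lagrange by (intro exI[of _ n] exI[of _ \<Phi>]) (auto simp: bij_betw_def)
qed

end

section \<open>The three spheres\<close>

lemma vector_4 [simp]:
  "(vector [w, x, y, z] :: 'a::zero^4) $ 1 = w"
  "(vector [w, x, y, z] :: 'a::zero^4) $ 2 = x"
  "(vector [w, x, y, z] :: 'a::zero^4) $ 3 = y"
  "(vector [w, x, y, z] :: 'a::zero^4) $ 4 = z"
  unfolding vector_def by simp_all

lemma continuous_on_vector_3:
  fixes f g h :: "'a::topological_space \<Rightarrow> real"
  assumes "continuous_on A f" "continuous_on A g" "continuous_on A h"
  shows "continuous_on A (\<lambda>x. vector [f x, g x, h x] :: real^3)"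
proof -
  have eq: "(\<lambda>x. vector [f x, g x, h x] :: real^3) =
      (\<lambda>x. \<chi> i. if i = 1 then f x else if i = 2 then g x else h x)"
    by (simp add: fun_eq_iff vec_eq_iff forall_3)
  have "continuous_on A (\<lambda>x. if i = 1 then f x else if i = 2 then g x else h x)" for i :: 3
    using assms by (cases "i = 1"; cases "i = 2") simp_all
  then show ?thesis
    unfolding eq by (rule continuous_on_vec_lambda)
qed

lemma continuous_on_vector_4:
  fixes f g h k :: "'a::topological_space \<Rightarrow> real"
  assumes "continuous_on A f" "continuous_on A g" "continuous_on A h" "continuous_on A k"
  shows "continuous_on A (\<lambda>x. vector [f x, g x, h x, k x] :: real^4)"
proof -
  have eq: "(\<lambda>x. vector [f x, g x, h x, k x] :: real^4) =
      (\<lambda>x. \<chi> i. if i = 1 then f x else if i = 2 then g x else if i = 3 then h x else k x)"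
    by (simp add: fun_eq_iff vec_eq_iff forall_4)
  have "continuous_on A (\<lambda>x. if i = 1 then f x else if i = 2 then g x else if i = 3 then h x else k x)"
    for i :: 4
    using assms by (cases "i = 1"; cases "i = 2"; cases "i = 3") simp_all
  then show ?thesis
    unfolding eq by (rule continuous_on_vec_lambda)
qed

lemma Gcd_range_eq_1I:
  fixes f :: "'a \<Rightarrow> int"
  assumes "\<And>d. (\<And>i. d dvd f i) \<Longrightarrow> d dvd 1"
  shows "Gcd (range f) = 1"
proof -
  have "Gcd (range f) dvd 1"
    by (rule assms) (simp add: Gcd_dvd)
  then show ?thesis
    by (metis is_unit_normalize normalize_Gcd)
qed

text \<open>With the gcd divided out, d'^2 is coprime to q'^2 and hence divides 2, so |d'| = 1. On
  the cone p . p = 2 q^2 this passes a common divisor of the entries of p on to q.\<close>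

lemma int_dvd_if_square_dvd_twice_square:
  fixes d q :: int
  assumes "d\<^sup>2 dvd 2 * q\<^sup>2"
  shows "d dvd q"
proof (cases "d = 0")
  case True
  with assms show ?thesis by simp
next
  case False
  then obtain d' q' where *: "d = d' * gcd d q" "q = q' * gcd d q" "coprime d' q'"
    using gcd_coprime_exists[of d q] by auto
  have "gcd d q \<noteq> 0"
    using False by simp
  have "d'\<^sup>2 * (gcd d q)\<^sup>2 dvd (2 * q'\<^sup>2) * (gcd d q)\<^sup>2"
    using assms by (subst (asm) *(1), subst (asm) *(2)) (simp add: power_mult_distrib mult_ac)
  then have "d'\<^sup>2 dvd 2 * q'\<^sup>2"
    using \<open>gcd d q \<noteq> 0\<close> by (simp only: dvd_times_right_cancel_iff power_not_zero not_False_eq_True)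
  then have "d'\<^sup>2 dvd 2"
    using *(3) by (simp add: coprime_dvd_mult_left_iff)
  then have "d'\<^sup>2 \<le> 2"
    by (rule zdvd_imp_le) simp
  moreover have "d' \<noteq> 0"
    using * False by auto
  ultimately have "\<bar>d'\<bar> = 1"
    using power_mono[of 2 "\<bar>d'\<bar>" 2] by (cases "\<bar>d'\<bar> \<ge> 2") auto
  then have "d dvd gcd d q"
    by (subst *(1)) (auto simp: abs_if split: if_splits)
  then show ?thesis
    by simp
qed

lemma quadratic_field_eq_quad_field:
  assumes "euclidean_quadratic_order \<theta> \<tau> \<nu>" and \<theta>: "\<theta> = of_rat r + of_rat r' * csqrt (of_int m)" "r' \<noteq> 0"
  shows "euclidean_quadratic_order.quad_field \<theta> = quadratic_field m"
proof -
  interpret euclidean_quadratic_order \<theta> \<tau> \<nu>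
    by fact
  have of_rat: "of_real (of_rat x) = (of_rat x :: complex)" for x
    by (cases x) (simp add: of_rat_rat)
  show ?thesis
  proof (intro equalityI subsetI)
    fix z assume "z \<in> quad_field"
    then obtain a b where z: "z = lin_comb (of_rat a) (of_rat b)"
      unfolding quad_field_def by (auto elim!: Rats_cases)
    have "z = of_rat (a + b * r) + of_rat (b * r') * csqrt (of_int m)"
      unfolding z lin_comb_def of_rat
      by (simp add: \<theta>(1) of_rat_add of_rat_mult algebra_simps)
    then show "z \<in> quadratic_field m"
      unfolding quadratic_field_def by blast
  next
    fix z assume "z \<in> quadratic_field m"
    then obtain a b where z: "z = of_rat a + of_rat b * csqrt (of_int m)"
      unfolding quadratic_field_def by blast
    have "(of_rat r' :: complex) \<noteq> 0"
      using \<theta>(2) by simp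
    \<comment> \<open>Solve theta = r + r' sqrt(m) for sqrt(m), which is possible since r' is
      nonzero.\<close>
    then have "z = lin_comb (of_rat (a - b / r' * r)) (of_rat (b / r'))"
      unfolding z lin_comb_def of_rat
      by (simp add: \<theta>(1) of_rat_mult of_rat_diff of_rat_divide field_simps)
    then show "z \<in> quad_field"
      unfolding quad_field_def by (auto intro: Rats_of_rat)
  qed
qed

text \<open>Points \<open>(p, q)\<close> of the cone \<open>p \<bullet> p = q\<^sup>2\<close> are written \<open>a e + c f + x (0, 1, 0, 0) + y (1, 0, 1, 1)\<close> with
  \<open>e = (0, 0, 1, 1)\<close> and \<open>f = (1, 0, 0, 1)\<close>; the cone becomes \<open>2 a c = x\<^sup>2 + y\<^sup>2\<close>, and
  \<open>x + \<i> y = (1 + \<i>) (s + \<i> t)\<close> turns it into \<open>a c = s\<^sup>2 + t\<^sup>2\<close>.\<close>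
lemma sphere_I_parametrization:
  "\<exists>(n :: real^3) (\<Phi> :: complex \<Rightarrow> real^3).
     n \<in> sphere_I \<inter> rational_points \<and>
     continuous_on UNIV \<Phi> \<and> bij_betw \<Phi> UNIV (sphere_I - {n}) \<and>
     \<Phi> ` quadratic_field (-1) = (sphere_I \<inter> rational_points) - {n} \<and>
     (\<forall>\<xi>. \<xi> \<notin> quadratic_field (-1) \<longrightarrow>
        lagrange_number (quadratic_field (-1)) (field_height (quadratic_field (-1))) \<xi> =
        ennreal (sqrt 2) * lagrange_number (sphere_I \<inter> rational_points) rational_height (\<Phi> \<xi>))"
proof -
  interpret euclidean_quadratic_order \<i> 0 1
    by unfold_locales simp_all
  have quad_field: "quad_field = quadratic_field (-1)"
    by (rule quadratic_field_eq_quad_field[of _ 0 1 0 1]) (unfold_locales, simp_all)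
  \<comment> \<open>The cone point with c = 1 and a = s^2 + t^2. Expanding (1 + i)(s + i t) gives x
    = s - t and y = s + t.\<close>
  define N :: "real \<Rightarrow> real \<Rightarrow> real" where "N = (\<lambda>s t. s\<^sup>2 + t\<^sup>2 + 1 + (s + t))"
  define P :: "real \<Rightarrow> real \<Rightarrow> real^3" where
    "P = (\<lambda>s t. vector [1 + (s + t), s - t, s\<^sup>2 + t\<^sup>2 + (s + t)])"
  have N_ge: "1 / 4 \<le> N s t" for s t
  proof -
    have "N s t = (s + 1 / 2)\<^sup>2 + (t + 1 / 2)\<^sup>2 + 1 / 2"
      by (simp add: N_def power2_eq_square field_simps)
    then show ?thesis by simp
  qed
  have N_pos: "0 < N s t" for s t
    using N_ge[of s t] by simp
  show ?thesis
    unfolding quad_field[symmetric]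
  proof (rule lagrange_number_parametrization[of "vector [0, 0, 1]" sphere_I P N 1])
    show "vector [0, 0, 1] \<in> sphere_I \<inter> rational_points"
      by (simp add: sphere_I_def rational_points_def sum_3 forall_3)
    show "continuous_on UNIV (\<lambda>x. P (fst x) (snd x))"
      unfolding P_def by (intro continuous_on_vector_3 continuous_intros)
    show "continuous_on UNIV (\<lambda>x. N (fst x) (snd x))"
      unfolding N_def by (intro continuous_intros)
    show "1 / 4 \<le> N s t" for s t
      by (rule N_ge)
    show "P s t \<bullet> P s' t' = 1 * N s t * N s' t' -
        ((s - s')\<^sup>2 + of_int 0 * (s - s') * (t - t') + of_int 1 * (t - t')\<^sup>2)" for s t s' t'
      by (simp add: P_def N_def inner_vec_def sum_3) (simp add: power2_eq_square algebra_simps)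
    show "P s t /\<^sub>R N s t \<in> sphere_I - {vector [0, 0, 1]}" for s t
    proof -
      have "(1 + (s + t))\<^sup>2 + (s - t)\<^sup>2 + (s\<^sup>2 + t\<^sup>2 + (s + t))\<^sup>2 = (N s t)\<^sup>2"
        by (simp add: N_def power2_eq_square algebra_simps)
      then have "P s t /\<^sub>R N s t \<in> sphere_I"
        using N_pos[of s t]
        by (simp add: sphere_I_def sum_3 P_def power_divide divide_inverse[symmetric] mult.commute[of "inverse _"]
            flip: add_divide_distrib)
      \<comment> \<open>The third coordinate of P is N - 1, so the quotient is never 1.\<close>
      moreover have "(P s t /\<^sub>R N s t) $ 3 \<noteq> (vector [0, 0, 1] :: real^3) $ 3"
        using N_pos[of s t] by (simp add: P_def N_def field_simps)
      ultimately show ?thesis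
        by (metis DiffI singletonD)
    qed
    fix x :: "real^3" assume "x \<in> sphere_I - {vector [0, 0, 1]}"
    then have x: "(x $ 1)\<^sup>2 + (x $ 2)\<^sup>2 + (x $ 3)\<^sup>2 = 1" "x \<noteq> vector [0, 0, 1]"
      by (simp_all add: sphere_I_def sum_3)
    \<comment> \<open>Cone coordinates read off at q = 1: q - p1 = a, q - p3 = c, p1 + p3 - q = s +
      t, p2 = s - t. Here s and t are already divided by c, which normalises c to 1.\<close>
    define a c s t where "a = 1 - x $ 1" and "c = 1 - x $ 3"
      and "s = (x $ 1 + x $ 2 + x $ 3 - 1) / (2 * c)" and "t = (x $ 1 - x $ 2 + x $ 3 - 1) / (2 * c)"
    have "c \<noteq> 0"
      using x by (auto simp: c_def vec_eq_iff forall_3)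
    have "(x $ 1 + x $ 2 + x $ 3 - 1)\<^sup>2 + (x $ 1 - x $ 2 + x $ 3 - 1)\<^sup>2 = 4 * a * c"
      using x(1) by (simp add: a_def c_def power2_eq_square algebra_simps)
    moreover have "s\<^sup>2 + t\<^sup>2 = ((x $ 1 + x $ 2 + x $ 3 - 1)\<^sup>2 + (x $ 1 - x $ 2 + x $ 3 - 1)\<^sup>2) / (2 * c)\<^sup>2"
      by (simp add: s_def t_def power_divide add_divide_distrib)
    ultimately have q: "s\<^sup>2 + t\<^sup>2 = a / c"
      using \<open>c \<noteq> 0\<close> by (simp add: power2_eq_square)
    have st: "s + t = (x $ 1 + x $ 3 - 1) / c" "s - t = x $ 2 / c"
      using \<open>c \<noteq> 0\<close> by (simp_all add: s_def t_def field_simps)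
    have x13: "x $ 1 = 1 - a" "x $ 3 = 1 - c"
      by (simp_all add: a_def c_def)
    have N: "N s t = 1 / c" and P: "P s t = vector [x $ 1 / c, x $ 2 / c, x $ 3 / c]"
      unfolding N_def P_def q st x13 using \<open>c \<noteq> 0\<close>
      by (simp_all add: vec_eq_iff forall_3 field_simps)
    have "x = P s t /\<^sub>R N s t"
      unfolding N P using \<open>c \<noteq> 0\<close> by (simp add: vec_eq_iff forall_3)
    moreover have "s \<in> \<rat> \<and> t \<in> \<rat>" if "x \<in> rational_points"
      using that by (simp add: rational_points_def s_def t_def c_def)
    ultimately show "\<exists>s t. x = P s t /\<^sub>R N s t \<and> (x \<in> rational_points \<longrightarrow> s \<in> \<rat> \<and> t \<in> \<rat>)"
      by blast
  next
    fix a c s t A B g h :: int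
    assume c: "0 < c" and ac: "a * c = s\<^sup>2 + 0 * s * t + 1 * t\<^sup>2"
      and one: "A * a + B * c + 2 * g * s + 0 * (g * t + h * s) + (0\<^sup>2 - 2 * 1) * h * t = 1"
    define p :: "int^3" where "p = vector [c + s + t, s - t, a + s + t]"
    define q where "q = a + c + s + t"
    have E: "real_of_int (a * c) = of_int (s\<^sup>2 + t\<^sup>2)"
      by (subst of_int_eq_iff) (use ac in simp)
    have ac': "(s / c)\<^sup>2 + (t / c)\<^sup>2 = a / c"
    proof -
      have "(s / c)\<^sup>2 + (t / c)\<^sup>2 = of_int (a * c) / (of_int c)\<^sup>2"
        unfolding E by (simp add: power_divide add_divide_distrib)
      then show ?thesis
        using c by (simp add: power2_eq_square)
    qed
    have "Gcd (range (\<lambda>i. p $ i)) = 1"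
    proof (rule Gcd_range_eq_1I)
      \<comment> \<open>A common divisor of the entries of p also divides q, because q^2 = p .
        p.\<close>
      fix d assume d: "\<And>i. d dvd p $ i"
      have "q\<^sup>2 = (p $ 1)\<^sup>2 + (p $ 2)\<^sup>2 + (p $ 3)\<^sup>2"
        using ac by (simp add: p_def q_def power2_eq_square algebra_simps)
      then have "d\<^sup>2 dvd q\<^sup>2"
        using d by (simp add: dvd_power_same)
      then have dq: "d dvd q"
        by simp
      \<comment> \<open>Only s + t and s - t are integer combinations of p and q here. They suffice
        because the certificate contains s and t as 2 g s - 2 h t = (g - h)(s + t) + (g + h)(s -
        t).\<close>
      have "1 = A * (q - p $ 1) + B * (q - p $ 3)
          + (g - h) * (p $ 1 + p $ 3 - q) + (g + h) * p $ 2"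
        using one by (simp add: p_def q_def algebra_simps)
      also have "d dvd \<dots>"
        using d dq by (intro dvd_add dvd_mult dvd_diff)
      finally show "d dvd 1" .
    qed
    moreover have "of_int q = of_int c * N (s / c) (t / c)"
      unfolding N_def ac' using c by (simp add: q_def field_simps)
    moreover have "of_int (p $ i) = of_int c * P (s / c) (t / c) $ i" for i
      unfolding P_def ac' using c exhaust_3[of i] by (auto simp: p_def field_simps)
    ultimately show "\<exists>(p :: int^3) q. Gcd (range (\<lambda>i. p $ i)) = 1 \<and> of_int q = of_int c * N (s / c) (t / c) \<and>
        (\<forall>i. of_int (p $ i) = of_int c * P (s / c) (t / c) $ i)"
      by blast
  qed
qed

text \<open>Here the cone is \<open>p \<bullet> p = 2 q\<^sup>2\<close>, with \<open>e = (1, 1, 0, 1)\<close>, \<open>f = (1, 0, 1, 1)\<close> and orthogonal complement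
  spanned by \<open>(1, 1, 1, 1)\<close> and \<open>(2, 0, 0, 1)\<close>; the coordinates \<open>x = - 2 t\<close>, \<open>y = s\<close> in that complement
  come from \<open>x + y \<surd>(-2) = \<surd>(-2) (s + t \<surd>(-2))\<close>.\<close>
lemma sphere_II_parametrization:
  "\<exists>(n :: real^3) (\<Phi> :: complex \<Rightarrow> real^3).
     n \<in> sphere_II \<inter> rational_points \<and>
     continuous_on UNIV \<Phi> \<and> bij_betw \<Phi> UNIV (sphere_II - {n}) \<and>
     \<Phi> ` quadratic_field (-2) = (sphere_II \<inter> rational_points) - {n} \<and>
     (\<forall>\<xi>. \<xi> \<notin> quadratic_field (-2) \<longrightarrow>
        lagrange_number (quadratic_field (-2)) (field_height (quadratic_field (-2))) \<xi> =
        ennreal (sqrt 2) * lagrange_number (sphere_II \<inter> rational_points) rational_height (\<Phi> \<xi>))"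
proof -
  interpret euclidean_quadratic_order "csqrt (-2)" 0 2
    by unfold_locales (simp_all add: power_mult_distrib flip: of_real_power)
  have quad_field: "quad_field = quadratic_field (-2)"
    by (rule quadratic_field_eq_quad_field[of _ 0 2 0 1]) (unfold_locales, simp_all)
  define N :: "real \<Rightarrow> real \<Rightarrow> real" where "N = (\<lambda>s t. s\<^sup>2 + 2 * t\<^sup>2 + 1 + s - 2 * t)"
  define P :: "real \<Rightarrow> real \<Rightarrow> real^3" where
    "P = (\<lambda>s t. vector [s\<^sup>2 + 2 * t\<^sup>2 + 1 + 2 * s - 2 * t, s\<^sup>2 + 2 * t\<^sup>2 - 2 * t, 1 - 2 * t])"
  \<comment> \<open>The common bound 1/4 comes from this sphere: it is the minimum of N, attained at
    s = -1/2, t = 1/2.\<close>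
  have N_ge: "1 / 4 \<le> N s t" for s t
  proof -
    have "N s t = (s + 1 / 2)\<^sup>2 + 2 * (t - 1 / 2)\<^sup>2 + 1 / 4"
      by (simp add: N_def power2_eq_square field_simps)
    then show ?thesis by simp
  qed
  have N_pos: "0 < N s t" for s t
    using N_ge[of s t] by simp
  show ?thesis
    unfolding quad_field[symmetric]
  proof (rule lagrange_number_parametrization[of "vector [1, 1, 0]" sphere_II P N 2])
    show "vector [1, 1, 0] \<in> sphere_II \<inter> rational_points"
      by (simp add: sphere_II_def rational_points_def sum_3 forall_3)
    show "continuous_on UNIV (\<lambda>x. P (fst x) (snd x))"
      unfolding P_def by (intro continuous_on_vector_3 continuous_intros)
    show "continuous_on UNIV (\<lambda>x. N (fst x) (snd x))"
      unfolding N_def by (intro continuous_intros)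
    show "1 / 4 \<le> N s t" for s t
      by (rule N_ge)
    show "P s t \<bullet> P s' t' = 2 * N s t * N s' t' -
        ((s - s')\<^sup>2 + of_int 0 * (s - s') * (t - t') + of_int 2 * (t - t')\<^sup>2)" for s t s' t'
      by (simp add: P_def N_def inner_vec_def sum_3) (simp add: power2_eq_square algebra_simps)
    show "P s t /\<^sub>R N s t \<in> sphere_II - {vector [1, 1, 0]}" for s t
    proof -
      have "(s\<^sup>2 + 2 * t\<^sup>2 + 1 + 2 * s - 2 * t)\<^sup>2 + (s\<^sup>2 + 2 * t\<^sup>2 - 2 * t)\<^sup>2 + (1 - 2 * t)\<^sup>2 = 2 * (N s t)\<^sup>2"
        by (simp add: N_def power2_eq_square algebra_simps)
      then have "P s t /\<^sub>R N s t \<in> sphere_II"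
        using N_pos[of s t]
        by (simp add: sphere_II_def sum_3 P_def power_divide divide_inverse[symmetric] mult.commute[of "inverse _"]
            flip: add_divide_distrib)
      \<comment> \<open>The first two coordinates of P add up to 2 N - 1, so they cannot both equal
        N.\<close>
      moreover have "P s t /\<^sub>R N s t \<noteq> vector [1, 1, 0]"
      proof
        assume eq: "P s t /\<^sub>R N s t = vector [1, 1, 0]"
        have "P s t $ 1 = N s t" "P s t $ 2 = N s t"
          using arg_cong[OF eq, of "\<lambda>x. x $ 1"] arg_cong[OF eq, of "\<lambda>x. x $ 2"] N_pos[of s t]
          by (simp_all add: field_simps)
        then show False
          by (simp add: P_def N_def)
      qed
      ultimately show ?thesis
        by (metis DiffI singletonD)
    qed
    fix x :: "real^3" assume "x \<in> sphere_II - {vector [1, 1, 0]}"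
    then have x: "(x $ 1)\<^sup>2 + (x $ 2)\<^sup>2 + (x $ 3)\<^sup>2 = 2" "x \<noteq> vector [1, 1, 0]"
      by (simp_all add: sphere_II_def sum_3)
    \<comment> \<open>On the cone, 2 q - p1 - p3 = a, 2 q - p1 - p2 = c, p1 - q = s and 2 q - p1 -
      p2 - p3 = 2 t; again q = 1, with s and t divided by c.\<close>
    define a c s t where "a = 2 - x $ 1 - x $ 3" and "c = 2 - x $ 1 - x $ 2"
      and "s = (x $ 1 - 1) / c" and "t = (2 - x $ 1 - x $ 2 - x $ 3) / (2 * c)"
    \<comment> \<open>The plane x1 + x2 = 2 is tangent to the sphere at (1, 1, 0), so c vanishes
      only at the removed point.\<close>
    have "c \<noteq> 0"
    proof
      assume "c = 0"
      then have x2: "x $ 2 = 2 - x $ 1"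
        by (simp add: c_def)
      with x(1) have "2 * (x $ 1 - 1)\<^sup>2 + (x $ 3)\<^sup>2 = 0"
        by (simp add: power2_eq_square algebra_simps)
      then have "x $ 1 = 1" "x $ 3 = 0"
        by (simp_all add: add_nonneg_eq_0_iff)
      with x2 x(2) show False
        by (simp add: vec_eq_iff forall_3)
    qed
    have "4 * (x $ 1 - 1)\<^sup>2 + 2 * (2 - x $ 1 - x $ 2 - x $ 3)\<^sup>2 = 4 * a * c"
      using x(1) by (simp add: a_def c_def power2_eq_square algebra_simps)
    moreover have "s\<^sup>2 + 2 * t\<^sup>2 = (4 * (x $ 1 - 1)\<^sup>2 + 2 * (2 - x $ 1 - x $ 2 - x $ 3)\<^sup>2) / (2 * c)\<^sup>2"
      by (simp add: s_def t_def power_divide power_mult_distrib add_divide_distrib)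
    ultimately have q: "s\<^sup>2 + 2 * t\<^sup>2 = a / c"
      using \<open>c \<noteq> 0\<close> by (simp add: power2_eq_square)
    have t2: "2 * t = (2 - x $ 1 - x $ 2 - x $ 3) / c"
      unfolding t_def using \<open>c \<noteq> 0\<close> by (simp only: times_divide_eq_right mult_divide_mult_cancel_left_if) simp
    have x23: "x $ 2 = 2 - c - x $ 1" "x $ 3 = 2 - a - x $ 1"
      by (simp_all add: a_def c_def)
    have N: "N s t = 1 / c" and P: "P s t = vector [x $ 1 / c, x $ 2 / c, x $ 3 / c]"
      unfolding N_def P_def q t2 unfolding s_def x23 using \<open>c \<noteq> 0\<close>
      by (simp_all add: vec_eq_iff forall_3 field_simps)
    have "x = P s t /\<^sub>R N s t"
      unfolding N P using \<open>c \<noteq> 0\<close> by (simp add: vec_eq_iff forall_3)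
    moreover have "s \<in> \<rat> \<and> t \<in> \<rat>" if "x \<in> rational_points"
      using that by (simp add: rational_points_def s_def t_def c_def)
    ultimately show "\<exists>s t. x = P s t /\<^sub>R N s t \<and> (x \<in> rational_points \<longrightarrow> s \<in> \<rat> \<and> t \<in> \<rat>)"
      by blast
  next
    fix a c s t A B g h :: int
    assume c: "0 < c" and ac: "a * c = s\<^sup>2 + 0 * s * t + 2 * t\<^sup>2"
      and one: "A * a + B * c + 2 * g * s + 0 * (g * t + h * s) + (0\<^sup>2 - 2 * 2) * h * t = 1"
    define p :: "int^3" where "p = vector [a + c + 2 * s - 2 * t, a - 2 * t, c - 2 * t]"
    define q where "q = a + c + s - 2 * t"
    have E: "real_of_int (a * c) = of_int (s\<^sup>2 + 2 * t\<^sup>2)"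
      by (subst of_int_eq_iff) (use ac in simp)
    have ac': "(s / c)\<^sup>2 + 2 * (t / c)\<^sup>2 = a / c"
    proof -
      have "(s / c)\<^sup>2 + 2 * (t / c)\<^sup>2 = of_int (a * c) / (of_int c)\<^sup>2"
        unfolding E by (simp add: power_divide add_divide_distrib)
      then show ?thesis
        using c by (simp add: power2_eq_square)
    qed
    have "Gcd (range (\<lambda>i. p $ i)) = 1"
    proof (rule Gcd_range_eq_1I)
      fix d assume d: "\<And>i. d dvd p $ i"
      have "2 * q\<^sup>2 = (p $ 1)\<^sup>2 + (p $ 2)\<^sup>2 + (p $ 3)\<^sup>2"
        using ac by (simp add: p_def q_def power2_eq_square algebra_simps)
      then have "d\<^sup>2 dvd 2 * q\<^sup>2"
        using d by (simp add: dvd_power_same)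
      then have dq: "d dvd q"
        by (rule int_dvd_if_square_dvd_twice_square)
      \<comment> \<open>Only 2 t, not t, is recovered from p and q; this matches the coefficient -4
        h of t in the certificate.\<close>
      have "1 = A * (2 * q - p $ 1 - p $ 3) + B * (2 * q - p $ 1 - p $ 2)
          + (2 * g) * (p $ 1 - q)
          + (2 * h) * (p $ 1 + p $ 2 + p $ 3 - 2 * q)"
        using one by (simp add: p_def q_def algebra_simps)
      also have "d dvd \<dots>"
        using d dq by (intro dvd_add dvd_mult dvd_diff)
      finally show "d dvd 1" .
    qed
    moreover have "of_int q = of_int c * N (s / c) (t / c)"
      unfolding N_def ac' using c by (simp add: q_def field_simps)
    moreover have "of_int (p $ i) = of_int c * P (s / c) (t / c) $ i" for i
      unfolding P_def ac' using c exhaust_3[of i] by (auto simp: p_def field_simps)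
    ultimately show "\<exists>(p :: int^3) q. Gcd (range (\<lambda>i. p $ i)) = 1 \<and> of_int q = of_int c * N (s / c) (t / c) \<and>
        (\<forall>i. of_int (p $ i) = of_int c * P (s / c) (t / c) $ i)"
      by blast
  qed
qed

text \<open>The cone is \<open>p \<bullet> p = q\<^sup>2\<close> with \<open>q\<close> the sum of the entries of \<open>p\<close>; here \<open>e = (1, 0, 0, 0)\<close> and
  \<open>f = (0, 1, 0, 0)\<close>, with orthogonal complement spanned by \<open>(-1, -1, 1, 0)\<close> and \<open>(-1, -1, 0, 1)\<close>.\<close>
lemma sphere_III_parametrization:
  "\<exists>(n :: real^4) (\<Phi> :: complex \<Rightarrow> real^4).
     n \<in> sphere_III \<inter> rational_points \<and>
     continuous_on UNIV \<Phi> \<and> bij_betw \<Phi> UNIV (sphere_III - {n}) \<and>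
     \<Phi> ` quadratic_field (-3) = (sphere_III \<inter> rational_points) - {n} \<and>
     (\<forall>\<xi>. \<xi> \<notin> quadratic_field (-3) \<longrightarrow>
        lagrange_number (quadratic_field (-3)) (field_height (quadratic_field (-3))) \<xi> =
        ennreal (sqrt 2) * lagrange_number (sphere_III \<inter> rational_points) rational_height (\<Phi> \<xi>))"
proof -
  interpret euclidean_quadratic_order "1 / 2 + 1 / 2 * csqrt (-3)" 1 1
    by unfold_locales (simp_all add: complex_eq_iff power2_eq_square)
  have quad_field: "quad_field = quadratic_field (-3)"
    by (rule quadratic_field_eq_quad_field[of _ 1 1 "1 / 2" "1 / 2"]) (unfold_locales, simp_all add: of_rat_divide)
  define N :: "real \<Rightarrow> real \<Rightarrow> real" where "N = (\<lambda>s t. s\<^sup>2 + s * t + t\<^sup>2 + 1 - s - t)"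
  define P :: "real \<Rightarrow> real \<Rightarrow> real^4" where
    "P = (\<lambda>s t. vector [s\<^sup>2 + s * t + t\<^sup>2 - s - t, 1 - s - t, s, t])"
  have N_ge: "1 / 4 \<le> N s t" for s t
  proof -
    have "N s t = (s + t / 2 - 1 / 2)\<^sup>2 + 3 / 4 * (t - 1 / 3)\<^sup>2 + 2 / 3"
      by (simp add: N_def power2_eq_square field_simps)
    then show ?thesis
      using zero_le_power2[of "s + t / 2 - 1 / 2"] zero_le_power2[of "t - 1 / 3"] by linarith
  qed
  have N_pos: "0 < N s t" for s t
    using N_ge[of s t] by simp
  show ?thesis
    unfolding quad_field[symmetric]
  proof (rule lagrange_number_parametrization[of "vector [1, 0, 0, 0]" sphere_III P N 1])
    show "vector [1, 0, 0, 0] \<in> sphere_III \<inter> rational_points"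
      by (simp add: sphere_III_def rational_points_def sum_4 forall_4)
    show "continuous_on UNIV (\<lambda>x. P (fst x) (snd x))"
      unfolding P_def by (intro continuous_on_vector_4 continuous_intros)
    show "continuous_on UNIV (\<lambda>x. N (fst x) (snd x))"
      unfolding N_def by (intro continuous_intros)
    show "1 / 4 \<le> N s t" for s t
      by (rule N_ge)
    show "P s t \<bullet> P s' t' = 1 * N s t * N s' t' -
        ((s - s')\<^sup>2 + of_int 1 * (s - s') * (t - t') + of_int 1 * (t - t')\<^sup>2)" for s t s' t'
      by (simp add: P_def N_def inner_vec_def sum_4) (simp add: power2_eq_square algebra_simps)
    show "P s t /\<^sub>R N s t \<in> sphere_III - {vector [1, 0, 0, 0]}" for s t
    proof -
      have "(s\<^sup>2 + s * t + t\<^sup>2 - s - t)\<^sup>2 + (1 - s - t)\<^sup>2 + s\<^sup>2 + t\<^sup>2 = (N s t)\<^sup>2"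
        "(s\<^sup>2 + s * t + t\<^sup>2 - s - t) + (1 - s - t) + s + t = N s t"
        by (simp_all add: N_def power2_eq_square algebra_simps)
      then have "P s t /\<^sub>R N s t \<in> sphere_III"
        using N_pos[of s t]
        by (simp add: sphere_III_def sum_4 P_def power_divide divide_inverse[symmetric] mult.commute[of "inverse _"]
            flip: add_divide_distrib)
      moreover have "(P s t /\<^sub>R N s t) $ 1 \<noteq> (vector [1, 0, 0, 0] :: real^4) $ 1"
        using N_pos[of s t] by (simp add: P_def N_def field_simps)
      ultimately show ?thesis
        by (metis DiffI singletonD)
    qed
    fix x :: "real^4" assume "x \<in> sphere_III - {vector [1, 0, 0, 0]}"
    then have x: "x $ 1 + x $ 2 + x $ 3 + x $ 4 = 1" "(x $ 1)\<^sup>2 + (x $ 2)\<^sup>2 + (x $ 3)\<^sup>2 + (x $ 4)\<^sup>2 = 1"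
        "x \<noteq> vector [1, 0, 0, 0]"
      by (simp_all add: sphere_III_def sum_4)
    \<comment> \<open>Adding the last two entries to the first or to the second cancels the
      contribution of the orthogonal complement and isolates a or c.\<close>
    define a c s t where "a = x $ 1 + x $ 3 + x $ 4" and "c = x $ 2 + x $ 3 + x $ 4"
      and "s = x $ 3 / c" and "t = x $ 4 / c"
    have x1: "x $ 1 = 1 - c" and x2: "x $ 2 = c - x $ 3 - x $ 4"
      using x(1) by (simp_all add: c_def)
    have "c \<noteq> 0"
    proof
      assume "c = 0"
      with x1 x(2) have "(x $ 2)\<^sup>2 + (x $ 3)\<^sup>2 + (x $ 4)\<^sup>2 = 0" "x $ 1 = 1"
        by simp_all
      then have "x $ 2 = 0" "x $ 3 = 0" "x $ 4 = 0"
        by (simp_all add: add_nonneg_eq_0_iff)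
      with \<open>x $ 1 = 1\<close> x(3) show False
        by (simp add: vec_eq_iff forall_4)
    qed
    have q: "s\<^sup>2 + s * t + t\<^sup>2 = a / c"
    proof -
      have "(x $ 3)\<^sup>2 + x $ 3 * x $ 4 + (x $ 4)\<^sup>2 = a * c"
        using x(2) unfolding a_def x1 x2 by (simp add: power2_eq_square algebra_simps)
      then show ?thesis
        using \<open>c \<noteq> 0\<close> by (simp add: s_def t_def power_divide field_simps power2_eq_square)
    qed
    have a: "a = 1 - c + x $ 3 + x $ 4"
      by (simp add: a_def x1)
    have N: "N s t = 1 / c" and P: "P s t = vector [x $ 1 / c, x $ 2 / c, x $ 3 / c, x $ 4 / c]"
      unfolding N_def P_def q using \<open>c \<noteq> 0\<close>
      by (simp_all add: vec_eq_iff forall_4 s_def t_def a x1 x2 field_simps)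
    have "x = P s t /\<^sub>R N s t"
      unfolding N P using \<open>c \<noteq> 0\<close> by (simp add: vec_eq_iff forall_4)
    moreover have "s \<in> \<rat> \<and> t \<in> \<rat>" if "x \<in> rational_points"
      using that by (simp add: rational_points_def s_def t_def c_def)
    ultimately show "\<exists>s t. x = P s t /\<^sub>R N s t \<and> (x \<in> rational_points \<longrightarrow> s \<in> \<rat> \<and> t \<in> \<rat>)"
      by blast
  next
    fix a c s t A B g h :: int
    assume c: "0 < c" and ac: "a * c = s\<^sup>2 + 1 * s * t + 1 * t\<^sup>2"
      and one: "A * a + B * c + 2 * g * s + 1 * (g * t + h * s) + (1\<^sup>2 - 2 * 1) * h * t = 1"
    define p :: "int^4" where "p = vector [a - s - t, c - s - t, s, t]"
    define q where "q = a + c - s - t"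
    have E: "real_of_int (a * c) = of_int (s\<^sup>2 + s * t + t\<^sup>2)"
      by (subst of_int_eq_iff) (use ac in simp)
    have ac': "(s / c)\<^sup>2 + (s / c) * (t / c) + (t / c)\<^sup>2 = a / c"
    proof -
      have "(s / c)\<^sup>2 + (s / c) * (t / c) + (t / c)\<^sup>2 = of_int (a * c) / (of_int c)\<^sup>2"
        unfolding E by (simp add: power_divide add_divide_distrib) (simp add: power2_eq_square)
      then show ?thesis
        using c by (simp add: power2_eq_square)
    qed
    have "Gcd (range (\<lambda>i. p $ i)) = 1"
    proof (rule Gcd_range_eq_1I)
      fix d assume "\<And>i. d dvd p $ i"
      from this[of 1] this[of 2] this[of 3] this[of 4]
      have d: "d dvd a - s - t" "d dvd c - s - t" "d dvd s" "d dvd t"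
        by (simp_all add: p_def)
      \<comment> \<open>All four cone coordinates are integer combinations of the entries of p, so
        the certificate applies directly.\<close>
      have "1 = A * ((a - s - t) + s + t) + B * ((c - s - t) + s + t) + (2 * g + h) * s + (g - h) * t"
        using one by (simp add: algebra_simps)
      also have "d dvd \<dots>"
        using d by (intro dvd_add dvd_mult)
      finally show "d dvd 1" .
    qed
    moreover have "of_int q = of_int c * N (s / c) (t / c)"
      unfolding N_def ac' using c by (simp add: q_def field_simps)
    moreover have "of_int (p $ i) = of_int c * P (s / c) (t / c) $ i" for i
      unfolding P_def ac' using c exhaust_4[of i] by (auto simp: p_def field_simps)
    ultimately show "\<exists>(p :: int^4) q. Gcd (range (\<lambda>i. p $ i)) = 1 \<and> of_int q = of_int c * N (s / c) (t / c) \<and>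
        (\<forall>i. of_int (p $ i) = of_int c * P (s / c) (t / c) $ i)"
      by blast
  qed
qed

theorem theorem1p3:
  shows
    "(\<exists>(n :: real^3) (\<Phi> :: complex \<Rightarrow> real^3).
       n \<in> sphere_I \<inter> rational_points \<and>
       continuous_on UNIV \<Phi> \<and> bij_betw \<Phi> UNIV (sphere_I - {n}) \<and>
       \<Phi> ` quadratic_field (-1) = (sphere_I \<inter> rational_points) - {n} \<and>
       (\<forall>\<xi>. \<xi> \<notin> quadratic_field (-1) \<longrightarrow>
          lagrange_number (quadratic_field (-1)) (field_height (quadratic_field (-1))) \<xi> =
          ennreal (sqrt 2) * lagrange_number (sphere_I \<inter> rational_points) rational_height (\<Phi> \<xi>))) \<and>
     (\<exists>(n :: real^3) (\<Phi> :: complex \<Rightarrow> real^3).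
       n \<in> sphere_II \<inter> rational_points \<and>
       continuous_on UNIV \<Phi> \<and> bij_betw \<Phi> UNIV (sphere_II - {n}) \<and>
       \<Phi> ` quadratic_field (-2) = (sphere_II \<inter> rational_points) - {n} \<and>
       (\<forall>\<xi>. \<xi> \<notin> quadratic_field (-2) \<longrightarrow>
          lagrange_number (quadratic_field (-2)) (field_height (quadratic_field (-2))) \<xi> =
          ennreal (sqrt 2) * lagrange_number (sphere_II \<inter> rational_points) rational_height (\<Phi> \<xi>))) \<and>
     (\<exists>(n :: real^4) (\<Phi> :: complex \<Rightarrow> real^4).
       n \<in> sphere_III \<inter> rational_points \<and>
       continuous_on UNIV \<Phi> \<and> bij_betw \<Phi> UNIV (sphere_III - {n}) \<and>
       \<Phi> ` quadratic_field (-3) = (sphere_III \<inter> rational_points) - {n} \<and>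
       (\<forall>\<xi>. \<xi> \<notin> quadratic_field (-3) \<longrightarrow>
          lagrange_number (quadratic_field (-3)) (field_height (quadratic_field (-3))) \<xi> =
          ennreal (sqrt 2) * lagrange_number (sphere_III \<inter> rational_points) rational_height (\<Phi> \<xi>)))"
  using sphere_I_parametrization sphere_II_parametrization sphere_III_parametrization by blast

end
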